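(* Let $\mathcal{H}$ be a Hilbert space, and let $\mathfrak{A}\subset B(\mathcal{H})$ be a unital $\mathrm{C}^*$-algebra containing the ideal $\mathfrak{K}$ of compact operators on $\mathcal{H}$ such that $\mathfrak{A}/\mathfrak{K}$ is commutative. Let $\mathcal{A}\subset\mathfrak{A}$ be a unital norm-closed subalgebra such that for every character $\omega$ on $\mathfrak{A}$ there is a pure contraction $t_\omega\in\mathcal{A}$ with $|\chi(t_\omega)|<1=\omega(t_\omega)$ for every character $\chi\neq\omega$ on $\mathfrak{A}$. Then every pure state on $\mathfrak{A}$ admits a characteristic sequence in $\mathfrak{S}+\mathfrak{K}$, where $\mathfrak{S}=\mathcal{A}+\mathcal{A}^*$ is the operator system generated by $\mathcal{A}$.
   Context: An operator $T\in B(\mathcal{H})$ is a pure contraction if $\|T\|\le1$ and $\lim_{n\to\infty}\|T^{*n}\xi\|=0$ for every $\xi\in\mathcal{H}$. A sequence $(\Delta_n)_n$ in $\mathfrak{A}$ is a characteristic sequence for a state $\psi$ if (a) $\|\Delta_n\|=1$ for all $n$, (b) $\lim_{n\to\infty}\psi(\Delta_n)=1$, and (c) $\limsup_{n\to\infty}\|\Delta_n^*a\Delta_n\|\le|\psi(a)|$ for every $a\in\mathfrak{A}$. *)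

theory Defs
  imports "HOL-Analysis.Analysis"
begin

text \<open>A complex Hilbert space, presented as a real Hilbert space (real inner product
  Re of the complex one) together with multiplication by the imaginary unit, jmul,
  which is a real-linear isometry with jmul o jmul = -id.\<close>
class chilbert = real_inner + complete_space +
  fixes jmul :: "'a \<Rightarrow> 'a"
  assumes jmul_add: "jmul (x + y) = jmul x + jmul y"
    and jmul_scaleR: "jmul (r *\<^sub>R x) = r *\<^sub>R jmul x"
    and jmul_jmul: "jmul (jmul x) = - x"
    and jmul_inner: "inner (jmul x) (jmul y) = inner x y"

definition clinear_op :: "('a::chilbert \<Rightarrow>\<^sub>L 'a) \<Rightarrow> bool" where
  "clinear_op T \<longleftrightarrow> (\<forall>x. blinfun_apply T (jmul x) = jmul (blinfun_apply T x))"

definition BH :: "('a::chilbert \<Rightarrow>\<^sub>L 'a) set" where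
  "BH = {T. clinear_op T}"

definition jop :: "'a::chilbert \<Rightarrow>\<^sub>L 'a" where
  "jop = Blinfun jmul"

definition cscaleL :: "complex \<Rightarrow> ('a::chilbert \<Rightarrow>\<^sub>L 'a) \<Rightarrow> ('a \<Rightarrow>\<^sub>L 'a)" where
  "cscaleL c T = Re c *\<^sub>R T + Im c *\<^sub>R (jop o\<^sub>L T)"

definition adjL :: "('a::chilbert \<Rightarrow>\<^sub>L 'a) \<Rightarrow> ('a \<Rightarrow>\<^sub>L 'a)" where
  "adjL T = (THE S. \<forall>x y. inner (blinfun_apply T x) y = inner x (blinfun_apply S y))"

definition compact_op :: "('a::chilbert \<Rightarrow>\<^sub>L 'a) \<Rightarrow> bool" where
  "compact_op T \<longleftrightarrow> compact (closure (blinfun_apply T ` ball 0 1))"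

definition Kset :: "('a::chilbert \<Rightarrow>\<^sub>L 'a) set" where
  "Kset = {T \<in> BH. compact_op T}"

definition complex_subspace :: "('a::chilbert \<Rightarrow>\<^sub>L 'a) set \<Rightarrow> bool" where
  "complex_subspace A \<longleftrightarrow> 0 \<in> A \<and> (\<forall>a\<in>A. \<forall>b\<in>A. a + b \<in> A) \<and> (\<forall>c. \<forall>a\<in>A. cscaleL c a \<in> A)"

definition unital_closed_subalg :: "('a::chilbert \<Rightarrow>\<^sub>L 'a) set \<Rightarrow> bool" where
  "unital_closed_subalg A \<longleftrightarrow> A \<subseteq> BH \<and> complex_subspace A \<and>
     (\<forall>a\<in>A. \<forall>b\<in>A. a o\<^sub>L b \<in> A) \<and> id_blinfun \<in> A \<and> closed A"

definition unital_cstar_subalg :: "('a::chilbert \<Rightarrow>\<^sub>L 'a) set \<Rightarrow> bool" where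
  "unital_cstar_subalg A \<longleftrightarrow> unital_closed_subalg A \<and> (\<forall>a\<in>A. adjL a \<in> A)"

definition clinear_on :: "('a::chilbert \<Rightarrow>\<^sub>L 'a) set \<Rightarrow> (('a \<Rightarrow>\<^sub>L 'a) \<Rightarrow> complex) \<Rightarrow> bool" where
  "clinear_on A f \<longleftrightarrow> (\<forall>a\<in>A. \<forall>b\<in>A. f (a + b) = f a + f b) \<and> (\<forall>c. \<forall>a\<in>A. f (cscaleL c a) = c * f a)"

text \<open>character: nonzero multiplicative linear functional (values outside A irrelevant)\<close>
definition character :: "('a::chilbert \<Rightarrow>\<^sub>L 'a) set \<Rightarrow> (('a \<Rightarrow>\<^sub>L 'a) \<Rightarrow> complex) \<Rightarrow> bool" where
  "character A \<omega> \<longleftrightarrow> clinear_on A \<omega> \<and> (\<forall>a\<in>A. \<forall>b\<in>A. \<omega> (a o\<^sub>L b) = \<omega> a * \<omega> b) \<and> \<omega> id_blinfun = 1"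

definition state :: "('a::chilbert \<Rightarrow>\<^sub>L 'a) set \<Rightarrow> (('a \<Rightarrow>\<^sub>L 'a) \<Rightarrow> complex) \<Rightarrow> bool" where
  "state A \<psi> \<longleftrightarrow> clinear_on A \<psi> \<and>
     (\<forall>a\<in>A. Im (\<psi> (adjL a o\<^sub>L a)) = 0 \<and> Re (\<psi> (adjL a o\<^sub>L a)) \<ge> 0) \<and> \<psi> id_blinfun = 1"

definition pure_state :: "('a::chilbert \<Rightarrow>\<^sub>L 'a) set \<Rightarrow> (('a \<Rightarrow>\<^sub>L 'a) \<Rightarrow> complex) \<Rightarrow> bool" where
  "pure_state A \<psi> \<longleftrightarrow> state A \<psi> \<and>
     (\<forall>\<phi>1 \<phi>2 (l::real). state A \<phi>1 \<and> state A \<phi>2 \<and> 0 < l \<and> l < 1 \<and>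
        (\<forall>a\<in>A. \<psi> a = of_real l * \<phi>1 a + of_real (1 - l) * \<phi>2 a) \<longrightarrow> (\<forall>a\<in>A. \<phi>1 a = \<psi> a))"

definition pure_contraction :: "('a::chilbert \<Rightarrow>\<^sub>L 'a) \<Rightarrow> bool" where
  "pure_contraction t \<longleftrightarrow> norm t \<le> 1 \<and>
     (\<forall>\<xi>. (\<lambda>n. (blinfun_apply (adjL t) ^^ n) \<xi>) \<longlonglongrightarrow> 0)"

definition characteristic_sequence ::
  "('a::chilbert \<Rightarrow>\<^sub>L 'a) set \<Rightarrow> (('a \<Rightarrow>\<^sub>L 'a) \<Rightarrow> complex) \<Rightarrow> (nat \<Rightarrow> ('a \<Rightarrow>\<^sub>L 'a)) \<Rightarrow> bool" where
  "characteristic_sequence A \<psi> \<Delta> \<longleftrightarrow> (\<forall>n. \<Delta> n \<in> A) \<and> (\<forall>n. norm (\<Delta> n) = 1) \<and>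
     (\<lambda>n. \<psi> (\<Delta> n)) \<longlonglongrightarrow> 1 \<and>
     (\<forall>a\<in>A. limsup (\<lambda>n. ereal (norm (adjL (\<Delta> n) o\<^sub>L a o\<^sub>L \<Delta> n))) \<le> ereal (cmod (\<psi> a)))"

definition opsys_plus_K :: "('a::chilbert \<Rightarrow>\<^sub>L 'a) set \<Rightarrow> ('a \<Rightarrow>\<^sub>L 'a) set" where
  "opsys_plus_K B = {a + adjL b + k | a b k. a \<in> B \<and> b \<in> B \<and> k \<in> Kset}"

end

theory Submission
  imports Defs
begin

text \<open>A pure state \<open>\<psi>\<close> that does not vanish on some rank-one operator dominates a multiple of a vector
  functional, so it is a vector state and the constant sequence consisting of the rank-one projection
  works.  Otherwise \<open>\<psi>\<close> vanishes on the compact operators and, the quotient being commutative, it is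
  a character; for its peaking element \<open>t\<close> the powers \<open>t\<^sup>n\<close> form a characteristic sequence.  Indeed,
  for \<open>\<psi>(b) = 0\<close> the quotient norms of \<open>b t\<^sup>m\<close> tend to zero, and the compact error is absorbed because
  \<open>t\<^sup>*\<^sup>n k \<rightarrow> 0\<close> in norm for compact \<open>k\<close>, by purity of \<open>t\<close>.

  The characters needed for the first claim come from seminorms: if \<open>p\<close> is a submultiplicative
  seminorm with \<open>p(x\<^sup>2) = p(x)\<^sup>2\<close> and \<open>p(a) = 1\<close>, then so is \<open>x \<mapsto> lim p(x a\<^sup>m)\<close>, and it is invariant
  under multiplication by \<open>a\<close>.  Hence a minimal such seminorm is multiplicative, and a multiplicative
  seminorm is the modulus of a character by a version of the Gelfand-Mazur theorem.\<close>

section \<open>Operators on a complex Hilbert space\<close>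

text \<open>The peak hypothesis gives |chi(t)| < 1 only one character at a time, whereas the limsup
  condition asks for decay in the norm of the quotient. Compactness of the character space would
  bridge this gap; here Zorn's lemma does. The quotient norms of \<open>b o\<^sub>L opow t m\<close>
  decrease, and their limit is itself the value at \<open>b\<close> of a power-multiplicative
  seminorm. If it were positive, a second localization at a multiple of \<open>b\<close> and a
  minimal seminorm below it would give a character of modulus 1 at \<open>t\<close>; as it does not
  vanish at \<open>b\<close>, it differs from \<psi> and contradicts the peak hypothesis.
  Commutativity of the quotient is what makes the quotient norm power-multiplicative, because all
  its elements become normal.\<close>

lemma riesz_representation_real:
  fixes f :: "'a::{real_inner,complete_space} \<Rightarrow> real"
  assumes "bounded_linear f"
  shows "\<exists>y. \<forall>x. f x = inner x y"
proof -
  interpret f: bounded_linear f by fact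
  obtain B where B: "\<And>x. \<bar>f x\<bar> \<le> norm x * B" using f.bounded by auto
  \<comment> \<open>\<open>J\<close> is the energy functional of the variational proof of Riesz'
    theorem. The parallelogram law (\<open>par\<close>) makes a minimising sequence Cauchy, and its
    limit represents \<open>f\<close>.\<close>
  define J where "J x = (norm x)\<^sup>2 - 2 * f x" for x
  have Jlow: "- (B\<^sup>2) \<le> J x" for x
  proof -
    have "0 \<le> (norm x - B)\<^sup>2" by simp
    then show ?thesis using B[of x] unfolding J_def power2_diff by (simp add: abs_le_iff)
  qed
  define m where "m = Inf (range J)"
  have bdd: "bdd_below (range J)" using Jlow by (intro bdd_belowI[where m="- (B\<^sup>2)"]) auto
  have mle: "m \<le> J x" for x unfolding m_def by (rule cInf_lower) (use bdd in auto)
  have "\<exists>x. J x < m + inverse (real (Suc n))" for n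
    using cInf_lessD[of "range J" "m + inverse (real (Suc n))"] unfolding m_def by auto
  then obtain X where X: "\<And>n. J (X n) < m + inverse (real (Suc n))" by metis
  have par: "(norm (x - y))\<^sup>2 \<le> 2 * (J x - m) + 2 * (J y - m)" for x y
  proof -
    have "(norm (x - y))\<^sup>2 = 2 * J x + 2 * J y - 4 * J ((1/2) *\<^sub>R (x + y))"
      unfolding J_def power2_norm_eq_inner f.scaleR f.add
      by (simp add: inner_simps inner_commute algebra_simps)
    with mle[of "(1/2) *\<^sub>R (x + y)"] show ?thesis by simp
  qed
  have "Cauchy X"
  proof (rule metric_CauchyI)
    fix e :: real assume e: "e > 0"
    obtain N where N: "inverse (real (Suc N)) < e\<^sup>2 / 4"
      using reals_Archimedean[of "e\<^sup>2/4"] e by auto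
    have small: "J (X n) - m < e\<^sup>2/4" if "n \<ge> N" for n
    proof -
      have "inverse (real (Suc n)) \<le> inverse (real (Suc N))" using that by (simp add: field_simps)
      then show ?thesis using X[of n] N by linarith
    qed
    have "dist (X k) (X n) < e" if "k \<ge> N" "n \<ge> N" for k n
    proof -
      have "(norm (X k - X n))\<^sup>2 < e\<^sup>2" using par[of "X k" "X n"] small[OF that(1)] small[OF that(2)] by argo
      then show ?thesis unfolding dist_norm using e by (meson less_eq_real_def power2_less_imp_less)
    qed
    then show "\<exists>M. \<forall>m\<ge>M. \<forall>n\<ge>M. dist (X m) (X n) < e" by blast
  qed
  then obtain y where y: "X \<longlonglongrightarrow> y" using Cauchy_convergent convergent_def by blast
  have "(\<lambda>n. J (X n)) \<longlonglongrightarrow> J y" unfolding J_def by (intro tendsto_intros y f.tendsto)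
  moreover have "(\<lambda>n. m + inverse (real (Suc n))) \<longlonglongrightarrow> m + 0"
    by (intro tendsto_intros LIMSEQ_inverse_real_of_nat)
  ultimately have Jy: "J y \<le> m" using X by (intro LIMSEQ_le[where X="\<lambda>n. J (X n)"]) (auto intro: less_imp_le)
  have "f x = inner x y" for x
  proof -
    define d where "d = inner x y - f x"
    define N where "N = (norm x)\<^sup>2"
    have N: "N \<ge> 0" by (simp add: N_def)
    have ineq: "0 \<le> 2 * s * d + s\<^sup>2 * N" for s
    proof -
      have "J (y + s *\<^sub>R x) = J y + 2 * s * d + s\<^sup>2 * N"
        unfolding J_def d_def N_def power2_norm_eq_inner f.scaleR f.add
        by (simp add: inner_simps inner_commute algebra_simps power2_eq_square)
      with mle[of "y + s *\<^sub>R x"] Jy show ?thesis by simp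
    qed
    \<comment> \<open>The parabola in \<open>s\<close> has its vertex at \<open>- d / N\<close>;
      using \<open>N + 1\<close> covers \<open>N = 0\<close> too and still gives a negative value
      unless \<open>d = 0\<close>.\<close>
    define c where "c = 1 / (N + 1)"
    have c: "c > 0" "c * N \<le> 1" using N by (auto simp: c_def)
    have "2 * (- d * c) * d + (- d * c)\<^sup>2 * N = (c * (2 - c * N)) * - (d\<^sup>2)"
      by (simp add: algebra_simps power2_eq_square)
    with ineq[of "- d * c"] have "0 \<le> (c * (2 - c * N)) * - (d\<^sup>2)" by simp
    moreover have "c * (2 - c * N) > 0" using c by simp
    ultimately have "0 \<le> - (d\<^sup>2)" using mult_le_cancel_left_pos[of "c * (2 - c * N)" 0 "- (d\<^sup>2)"] by simp
    then have "d = 0" by simp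
    then show ?thesis by (simp add: d_def)
  qed
  then show ?thesis by blast
qed

section \<open>The complex structure and complex scalars\<close>

lemma jmul_minus: "jmul (- x) = - jmul (x::'a::chilbert)"
  using jmul_scaleR[of "-1" x] by simp

lemma jmul_diff: "jmul (x - y) = jmul x - jmul (y::'a::chilbert)"
  using jmul_add[of x "- y"] by (simp add: jmul_minus)

lemma jmul_zero [simp]: "jmul (0::'a::chilbert) = 0"
  using jmul_scaleR[of 0 "0::'a"] by simp

lemma norm_jmul [simp]: "norm (jmul x) = norm (x::'a::chilbert)"
  by (simp add: norm_eq_sqrt_inner jmul_inner)

lemma jmul_skew: "inner (jmul x) y = - inner x (jmul (y::'a::chilbert))"
  using jmul_inner[of "jmul x" y] by (simp add: jmul_jmul)

lemma inner_jmul_self [simp]: "inner x (jmul x) = 0" "inner (jmul x) x = 0" for x :: "'a::chilbert"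
  using jmul_skew[of x x] by (auto simp: inner_commute)

lemma bounded_linear_jmul: "bounded_linear (jmul :: 'a::chilbert \<Rightarrow> 'a)"
  by (rule bounded_linear_intro[where K=1]) (simp_all add: jmul_add jmul_scaleR)

lemma jop_apply [simp]: "blinfun_apply jop x = jmul (x::'a::chilbert)"
  unfolding jop_def by (simp add: bounded_linear_Blinfun_apply bounded_linear_jmul)

lemmas jmul_simps = jmul_add jmul_diff jmul_minus jmul_scaleR jmul_jmul

lemma cscaleL_apply:
  "blinfun_apply (cscaleL c T) x = Re c *\<^sub>R blinfun_apply T x + Im c *\<^sub>R jmul (blinfun_apply T x)"
  by (simp add: cscaleL_def blinfun.bilinear_simps)

lemma BH_apply_jmul: "T \<in> BH \<Longrightarrow> blinfun_apply T (jmul x) = jmul (blinfun_apply T x)"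
  by (simp add: BH_def clinear_op_def)

text \<open>Pythagoras: \<open>x\<close> and \<open>jmul x\<close> are orthogonal and of equal
  norm.\<close>

lemma norm_scale_jmul: "norm (a *\<^sub>R x + b *\<^sub>R jmul x) = cmod (Complex a b) * norm (x::'a::chilbert)"
proof -
  have "(norm (a *\<^sub>R x + b *\<^sub>R jmul x))\<^sup>2 = (cmod (Complex a b) * norm x)\<^sup>2"
    unfolding power_mult_distrib cmod_power2 power2_norm_eq_inner
    by (simp add: inner_simps jmul_inner algebra_simps power2_eq_square)
  then show ?thesis by (simp add: power2_eq_iff_nonneg)
qed

lemma norm_cscaleL [simp]: "norm (cscaleL c T) = cmod c * norm T"
proof (cases "c = 0")
  case True
  then show ?thesis by (simp add: cscaleL_def)
next
  case False
  have ap: "norm (blinfun_apply (cscaleL c T) x) = cmod c * norm (blinfun_apply T x)" for x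
    using norm_scale_jmul[of "Re c" "blinfun_apply T x" "Im c"] by (simp add: cscaleL_apply)
  show ?thesis
  proof (rule antisym)
    show "norm (cscaleL c T) \<le> cmod c * norm T"
      by (rule norm_blinfun_bound) (auto simp: ap norm_blinfun mult.assoc intro: mult_left_mono)
    have "norm T \<le> norm (cscaleL c T) / cmod c"
    proof (rule norm_blinfun_bound)
      fix x
      show "norm (blinfun_apply T x) \<le> norm (cscaleL c T) / cmod c * norm x"
        using norm_blinfun[of "cscaleL c T" x] False by (simp add: ap field_simps)
    qed simp
    then show "cmod c * norm T \<le> norm (cscaleL c T)" using False by (simp add: field_simps)
  qed
qed

lemma cscaleL_simps:
  "cscaleL c (S + T) = cscaleL c S + cscaleL c T"
  "cscaleL (c + d) T = cscaleL c T + cscaleL d T"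
  "cscaleL (- c) T = - cscaleL c T"
  "cscaleL c (cscaleL d T) = cscaleL (c * d) T"
  "cscaleL (of_real r) T = r *\<^sub>R T"
  "cscaleL 1 T = T"
  "cscaleL 0 T = 0"
  by (rule blinfun_eqI; simp add: cscaleL_apply blinfun.bilinear_simps jmul_simps algebra_simps)+

lemma compose_simps:
  fixes R S T :: "'a::real_normed_vector \<Rightarrow>\<^sub>L 'a"
  shows "(R + S) o\<^sub>L T = (R o\<^sub>L T) + (S o\<^sub>L T)" "T o\<^sub>L (R + S) = (T o\<^sub>L R) + (T o\<^sub>L S)"
  "(R - S) o\<^sub>L T = (R o\<^sub>L T) - (S o\<^sub>L T)" "T o\<^sub>L (R - S) = (T o\<^sub>L R) - (T o\<^sub>L S)"
  "(r *\<^sub>R S) o\<^sub>L T = r *\<^sub>R (S o\<^sub>L T)" "S o\<^sub>L (r *\<^sub>R T) = r *\<^sub>R (S o\<^sub>L T)"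
  "(- S) o\<^sub>L T = - (S o\<^sub>L T)" "S o\<^sub>L (- T) = - (S o\<^sub>L T)"
  "(R o\<^sub>L S) o\<^sub>L T = R o\<^sub>L (S o\<^sub>L T)"
  "id_blinfun o\<^sub>L T = T" "T o\<^sub>L id_blinfun = T" "0 o\<^sub>L T = 0" "T o\<^sub>L 0 = 0"
  by (rule blinfun_eqI; simp add: blinfun.bilinear_simps)+

lemma compose_cscaleL:
  "cscaleL c S o\<^sub>L T = cscaleL c (S o\<^sub>L T)"
  "S \<in> BH \<Longrightarrow> S o\<^sub>L cscaleL c T = cscaleL c (S o\<^sub>L T)"
  by (rule blinfun_eqI; simp add: cscaleL_apply blinfun.bilinear_simps BH_apply_jmul)+

text \<open>Riesz gives the vector \<open>s y\<close> for each \<open>y\<close>, and Cauchy-Schwarz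
  bounds it. Only real linearity enters, so the definite description \<open>adjL\<close> makes sense
  for every bounded real-linear operator.\<close>

lemma adjL_exists:
  fixes T :: "'a::chilbert \<Rightarrow>\<^sub>L 'a"
  shows "\<exists>S. \<forall>x y. inner (blinfun_apply T x) y = inner x (blinfun_apply S y)"
proof -
  have "\<exists>z. \<forall>x. inner (blinfun_apply T x) y = inner x z" for y
    using riesz_representation_real[OF bounded_linear_compose[OF bounded_linear_inner_left blinfun.bounded_linear_right]] .
  then obtain s where s: "\<And>x y. inner (blinfun_apply T x) y = inner x (s y)" by metis
  have ext: "u = v" if "\<And>x. inner x u = inner x v" for u v :: 'a
    using that[of "u - v"] by (metis inner_diff_right inner_eq_zero_iff right_minus_eq)
  have "bounded_linear s"
  proof (rule bounded_linear_intro[where K="norm T"])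
    fix x y :: 'a and r :: real
    show "s (x + y) = s x + s y" by (rule ext) (simp add: inner_simps flip: s)
    show "s (r *\<^sub>R x) = r *\<^sub>R s x" by (rule ext) (simp add: inner_simps flip: s)
    have "norm (s x) * norm (s x) = inner (blinfun_apply T (s x)) x"
      by (simp add: s flip: power2_norm_eq_inner power2_eq_square)
    also have "\<dots> \<le> norm (blinfun_apply T (s x)) * norm x" by (rule norm_cauchy_schwarz)
    also have "\<dots> \<le> norm T * norm (s x) * norm x" by (intro mult_right_mono norm_blinfun) auto
    finally have "norm (s x) * norm (s x) \<le> norm (s x) * (norm x * norm T)" by (simp add: algebra_simps)
    then show "norm (s x) \<le> norm x * norm T"
      by (cases "norm (s x) = 0") (auto simp: mult_le_cancel_left)
  qed
  then show ?thesis using s by (intro exI[of _ "Blinfun s"]) (simp add: bounded_linear_Blinfun_apply)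
qed

lemma adjL_eqI:
  assumes "\<And>x y. inner (blinfun_apply T x) y = inner x (blinfun_apply S (y::'a::chilbert))"
  shows "adjL T = S"
  unfolding adjL_def
proof (rule the_equality)
  fix R assume R: "\<forall>x y. inner (blinfun_apply T x) y = inner x (blinfun_apply R y)"
  show "R = S"
  proof (rule blinfun_eqI)
    fix y
    have "inner (R y - S y) (R y - S y) = 0"
      using R assms by (metis inner_diff_right right_minus_eq)
    then show "R y = S y" by simp
  qed
qed (use assms in blast)

lemma adjL_inner: "inner (blinfun_apply T x) y = inner x (blinfun_apply (adjL T) (y::'a::chilbert))"
  using adjL_exists[of T] adjL_eqI[of T] by metis

lemma adjL_inner': "inner x (blinfun_apply T y) = inner (blinfun_apply (adjL T) x) (y::'a::chilbert)"
  using adjL_inner[of T y x] by (simp add: inner_commute)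

lemma adjL_simps [simp]:
  "adjL (S + T) = adjL S + adjL T"
  "adjL (S - T) = adjL S - adjL T"
  "adjL (- T) = - adjL T"
  "adjL (r *\<^sub>R T) = r *\<^sub>R adjL T"
  "adjL (adjL T) = T"
  "adjL id_blinfun = id_blinfun"
  "adjL (S o\<^sub>L T) = adjL T o\<^sub>L adjL S"
  "adjL 0 = 0"
  by (rule adjL_eqI; simp add: inner_simps blinfun.bilinear_simps adjL_inner adjL_inner'[of _ T])+

text \<open>\<open>jmul\<close> is skew for the real inner product, so the two signs cancel when
  adjoints are taken in the commutation of \<open>T\<close> with \<open>jmul\<close>. Hence the real
  adjoint of a complex-linear operator is its complex adjoint.\<close>

lemma adjL_BH: "T \<in> BH \<Longrightarrow> adjL T \<in> BH"
  unfolding BH_def clinear_op_def mem_Collect_eq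
proof
  fix x assume T: "\<forall>x. blinfun_apply T (jmul x) = jmul (blinfun_apply T x)"
  have "inner z (adjL T (jmul x) - jmul (adjL T x)) = 0" for z
  proof -
    have "inner z (adjL T (jmul x)) = inner (T z) (jmul x)" by (simp add: adjL_inner)
    also have "\<dots> = - inner (jmul (T z)) x" by (simp add: jmul_skew)
    also have "\<dots> = - inner (jmul z) (adjL T x)" using T by (simp flip: adjL_inner)
    finally show ?thesis by (simp add: jmul_skew inner_simps)
  qed
  then show "adjL T (jmul x) = jmul (adjL T x)" by (metis inner_eq_zero_iff right_minus_eq)
qed

lemma adjL_cscaleL: "T \<in> BH \<Longrightarrow> adjL (cscaleL c T) = cscaleL (cnj c) (adjL T)"
  by (rule adjL_eqI) (simp add: cscaleL_apply inner_simps blinfun.bilinear_simps adjL_inner jmul_skew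
      BH_apply_jmul adjL_BH)

lemma norm_adjL_le: "norm (adjL T) \<le> norm T"
proof (rule norm_blinfun_bound)
  fix x
  have "norm (adjL T x) * norm (adjL T x) = inner (T (adjL T x)) x"
    by (simp add: adjL_inner flip: power2_norm_eq_inner power2_eq_square)
  also have "\<dots> \<le> norm (T (adjL T x)) * norm x" by (rule norm_cauchy_schwarz)
  also have "\<dots> \<le> norm T * norm (adjL T x) * norm x" by (intro mult_right_mono norm_blinfun) auto
  finally have "norm (adjL T x) * norm (adjL T x) \<le> norm (adjL T x) * (norm T * norm x)"
    by (simp add: algebra_simps)
  then show "norm (adjL T x) \<le> norm T * norm x"
    by (cases "norm (adjL T x) = 0") (auto simp: mult_le_cancel_left)
qed simp

lemma norm_adjL [simp]: "norm (adjL T) = norm T"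
  using norm_adjL_le[of T] norm_adjL_le[of "adjL T"] by simp

text \<open>Half of the C*-identity, with the adjoint on the right: \<open>qnorm_cstar\<close>
  applies it to an element multiplied by a projection from the left.\<close>

lemma norm_sq_le_norm_compose_adjL: "(norm T)\<^sup>2 \<le> norm (T o\<^sub>L adjL T)"
proof -
  let ?M = "norm (T o\<^sub>L adjL T)"
  have "norm (adjL T) \<le> sqrt ?M"
  proof (rule norm_blinfun_bound)
    fix y
    have "(norm (adjL T y))\<^sup>2 = inner ((T o\<^sub>L adjL T) y) y"
      by (simp add: power2_norm_eq_inner adjL_inner)
    also have "\<dots> \<le> norm ((T o\<^sub>L adjL T) y) * norm y" by (rule norm_cauchy_schwarz)
    also have "\<dots> \<le> ?M * norm y * norm y" by (intro mult_right_mono norm_blinfun) auto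
    also have "\<dots> = (sqrt ?M * norm y)\<^sup>2" by (simp add: power_mult_distrib power2_eq_square)
    finally show "norm (adjL T y) \<le> sqrt ?M * norm y" by (rule power2_le_imp_le) simp
  qed simp
  then have "(norm T)\<^sup>2 \<le> (sqrt ?M)\<^sup>2" by (intro power_mono) auto
  then show ?thesis by simp
qed

lemma norm_adjL_compose: "norm (adjL T o\<^sub>L T) = (norm T)\<^sup>2"
proof (rule antisym)
  show "norm (adjL T o\<^sub>L T) \<le> (norm T)\<^sup>2"
    using norm_blinfun_compose[of "adjL T" T] by (simp add: power2_eq_square)
  show "(norm T)\<^sup>2 \<le> norm (adjL T o\<^sub>L T)" using norm_sq_le_norm_compose_adjL[of "adjL T"] by simp
qed

section \<open>Compact operators\<close>

text \<open>The complex rank-one operator that multiplies \<open>v\<close> by the complex inner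
  product of \<open>x\<close> and \<open>e\<close>, whose real part is \<open>inner x e\<close> and
  whose imaginary part is \<open>inner x (jmul e)\<close>.\<close>

definition rank1 :: "'a::chilbert \<Rightarrow> 'a \<Rightarrow> 'a \<Rightarrow>\<^sub>L 'a" where
  "rank1 v e = Blinfun (\<lambda>x. inner x e *\<^sub>R v + inner x (jmul e) *\<^sub>R jmul v)"

lemma cmod_inner_le: "cmod (Complex (inner x e) (inner x (jmul e))) \<le> norm x * norm (e::'a::chilbert)"
proof -
  let ?c = "cmod (Complex (inner x e) (inner x (jmul e)))"
  \<comment> \<open>\<open>?z\<close> is \<open>e\<close> times the complex inner product of
    \<open>x\<close> and \<open>e\<close>; pairing \<open>x\<close> with it produces the squared
    modulus.\<close>
  let ?z = "inner x e *\<^sub>R e + inner x (jmul e) *\<^sub>R jmul e"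
  have "?c * ?c = inner x ?z"
    using cmod_power2[of "Complex (inner x e) (inner x (jmul e))"]
    by (simp add: inner_simps power2_eq_square)
  also have "\<dots> \<le> norm x * norm ?z" by (rule norm_cauchy_schwarz)
  also have "\<dots> = ?c * (norm x * norm e)" by (simp add: norm_scale_jmul)
  finally show ?thesis by (cases "?c = 0") (auto simp: mult_le_cancel_left)
qed

lemma rank1_apply: "blinfun_apply (rank1 v e) x = inner x e *\<^sub>R v + inner x (jmul e) *\<^sub>R jmul v"
proof -
  have "bounded_linear (\<lambda>x. inner x e *\<^sub>R v + inner x (jmul e) *\<^sub>R jmul v)"
    by (intro bounded_linear_intros)
  then show ?thesis by (simp add: rank1_def bounded_linear_Blinfun_apply)
qed

lemma norm_rank1_le: "norm (rank1 v e) \<le> norm v * norm e"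
proof (rule norm_blinfun_bound)
  fix x
  show "norm (rank1 v e x) \<le> norm v * norm e * norm x"
    using mult_right_mono[OF cmod_inner_le[of x e], of "norm v"]
    by (simp add: rank1_apply norm_scale_jmul mult_ac)
qed simp

lemma rank1_BH [simp]: "rank1 v e \<in> BH"
  by (simp add: BH_def clinear_op_def rank1_apply jmul_simps jmul_inner jmul_skew)

lemma compose_rank1: "a \<in> BH \<Longrightarrow> a o\<^sub>L rank1 v e = rank1 (blinfun_apply a v) e"
  by (rule blinfun_eqI) (simp add: rank1_apply blinfun.bilinear_simps BH_apply_jmul)

lemma rank1_compose: "a \<in> BH \<Longrightarrow> rank1 v e o\<^sub>L a = rank1 v (blinfun_apply (adjL a) e)"
  by (rule blinfun_eqI) (simp add: rank1_apply adjL_inner BH_apply_jmul adjL_BH)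

lemma adjL_rank1 [simp]: "adjL (rank1 v e) = rank1 e v"
  by (rule adjL_eqI) (simp add: rank1_apply inner_simps inner_commute mult.commute)

lemma rank1_add: "rank1 (v + w) e = rank1 v e + rank1 w e"
  by (rule blinfun_eqI) (simp add: rank1_apply blinfun.bilinear_simps jmul_simps algebra_simps)

lemma rank1_scaleR: "rank1 (r *\<^sub>R v) e = r *\<^sub>R rank1 v e"
  by (rule blinfun_eqI) (simp add: rank1_apply blinfun.bilinear_simps jmul_simps algebra_simps)

lemma rank1_jmul: "rank1 (jmul v) e = cscaleL \<i> (rank1 v e)"
  by (rule blinfun_eqI) (simp add: rank1_apply cscaleL_apply jmul_simps)

lemma rank1_zero [simp]: "rank1 0 e = 0" "rank1 v 0 = 0"
  by (rule blinfun_eqI; simp add: rank1_apply)+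

lemma rank1_rank1: "rank1 e v o\<^sub>L rank1 v e = (norm v)\<^sup>2 *\<^sub>R rank1 e e"
  by (simp add: compose_rank1 rank1_apply rank1_scaleR power2_norm_eq_inner)

lemma BH_closed:
  "a \<in> BH \<Longrightarrow> b \<in> BH \<Longrightarrow> a + b \<in> BH" "a \<in> BH \<Longrightarrow> b \<in> BH \<Longrightarrow> a o\<^sub>L b \<in> BH"
  "a \<in> BH \<Longrightarrow> cscaleL c a \<in> BH" "id_blinfun \<in> BH" "0 \<in> BH"
  by (auto simp: BH_def clinear_op_def blinfun.bilinear_simps jmul_simps cscaleL_apply)

section \<open>The ideal of compact operators\<close>

lemma compact_opI:
  assumes "compact C" "\<And>x. norm x < 1 \<Longrightarrow> blinfun_apply T x \<in> C"
  shows "compact_op T"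
proof -
  have "closure (T ` ball 0 1) \<subseteq> C"
    by (rule closure_minimal) (use assms in \<open>auto intro: compact_imp_closed\<close>)
  then show ?thesis unfolding compact_op_def
    by (metis assms(1) closed_closure compact_Int_closed inf.absorb2)
qed

lemma compact_op_mem: "norm x < 1 \<Longrightarrow> blinfun_apply T x \<in> closure (T ` ball 0 1)"
  by (intro subsetD[OF closure_subset] imageI) simp

lemma Kset_BH: "k \<in> Kset \<Longrightarrow> k \<in> BH"
  by (simp add: Kset_def)

lemma Kset_add: "k \<in> Kset \<Longrightarrow> l \<in> Kset \<Longrightarrow> k + l \<in> Kset"
  unfolding Kset_def mem_Collect_eq
proof (intro conjI; elim conjE)
  assume c: "compact_op k" "compact_op l"
  show "compact_op (k + l)"
    by (rule compact_opI[OF compact_sums[OF c[unfolded compact_op_def]]])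
      (use compact_op_mem[of _ k] compact_op_mem[of _ l] in \<open>auto simp: blinfun.bilinear_simps\<close>)
qed (auto intro: BH_closed)

lemma Kset_compose_left: "a \<in> BH \<Longrightarrow> k \<in> Kset \<Longrightarrow> a o\<^sub>L k \<in> Kset"
  unfolding Kset_def mem_Collect_eq
proof (intro conjI; elim conjE)
  assume c: "compact_op k"
  have "compact (a ` closure (k ` ball 0 1))"
    using c unfolding compact_op_def
    by (intro compact_continuous_image linear_continuous_on blinfun.bounded_linear_right) auto
  then show "compact_op (a o\<^sub>L k)"
    by (rule compact_opI) (use compact_op_mem[of _ k] in auto)
qed (auto intro: BH_closed)

lemma Kset_compose_right: "a \<in> BH \<Longrightarrow> k \<in> Kset \<Longrightarrow> k o\<^sub>L a \<in> Kset"
  unfolding Kset_def mem_Collect_eq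
proof (intro conjI; elim conjE)
  assume c: "compact_op k"
  define r where "r = norm a + 1"
  have r: "r > 0" by (simp add: r_def add_nonneg_pos)
  have "compact ((*\<^sub>R) r ` closure (k ` ball 0 1))"
    using c unfolding compact_op_def by (rule compact_scaling)
  then show "compact_op (k o\<^sub>L a)"
  proof (rule compact_opI)
    fix x :: 'a assume x: "norm x < 1"
    have "norm (a x) \<le> norm a * norm x" by (rule norm_blinfun)
    also have "\<dots> \<le> norm a" using x by (simp add: mult_left_le)
    also have "\<dots> < r" by (simp add: r_def)
    finally have "norm ((1/r) *\<^sub>R a x) < 1" using r by simp
    from compact_op_mem[OF this, of k] have "r *\<^sub>R k ((1/r) *\<^sub>R a x) \<in> (*\<^sub>R) r ` closure (k ` ball 0 1)"
      by (rule imageI)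
    then show "(k o\<^sub>L a) x \<in> (*\<^sub>R) r ` closure (k ` ball 0 1)" using r by (simp add: blinfun.bilinear_simps)
  qed
qed (auto intro: BH_closed)

lemma Kset_cscaleL: "k \<in> Kset \<Longrightarrow> cscaleL c k \<in> Kset"
  using Kset_compose_left[of "cscaleL c id_blinfun" k] by (simp add: BH_closed compose_cscaleL compose_simps)

lemma Kset_scaleR: "k \<in> Kset \<Longrightarrow> r *\<^sub>R k \<in> Kset"
  using Kset_cscaleL[of k "of_real r"] by (simp add: cscaleL_simps)

lemma Kset_minus: "k \<in> Kset \<Longrightarrow> - k \<in> Kset"
  using Kset_scaleR[of k "-1"] by simp

lemma Kset_diff: "k \<in> Kset \<Longrightarrow> l \<in> Kset \<Longrightarrow> k - l \<in> Kset"
  using Kset_add[OF _ Kset_minus, of k l] by simp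

lemma Kset_zero [simp]: "0 \<in> Kset"
  unfolding Kset_def using compact_opI[of "{0}" 0] by (simp add: BH_closed)

lemma rank1_Kset [simp]: "rank1 v e \<in> Kset"
proof -
  let ?I = "cbox (- norm e) (norm e)"
  have "compact ((\<lambda>(a, b). a *\<^sub>R v + b *\<^sub>R jmul v) ` (?I \<times> ?I))"
    by (intro compact_continuous_image compact_Times compact_cbox)
      (auto simp: case_prod_unfold intro!: continuous_intros)
  then have "compact_op (rank1 v e)"
  proof (rule compact_opI)
    fix x :: 'a assume x: "norm x < 1"
    have "\<bar>inner x f\<bar> \<le> norm e" if "norm f = norm e" for f
    proof -
      have "\<bar>inner x f\<bar> \<le> norm x * norm f" by (rule Cauchy_Schwarz_ineq2)
      also have "\<dots> \<le> norm e" using x that by (simp add: mult_left_le_one_le)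
      finally show ?thesis .
    qed
    from this[of e] this[of "jmul e"] have "inner x e \<in> ?I" "inner x (jmul e) \<in> ?I" by (auto simp: abs_le_iff)
    then show "rank1 v e x \<in> (\<lambda>(a, b). a *\<^sub>R v + b *\<^sub>R jmul v) ` (?I \<times> ?I)"
      by (force simp: rank1_apply)
  qed
  then show ?thesis by (simp add: Kset_def)
qed

section \<open>Approximation by finite-rank projections\<close>

inductive_set finrank :: "('a::chilbert \<Rightarrow>\<^sub>L 'a) set" where
  "0 \<in> finrank"
| "T \<in> finrank \<Longrightarrow> T + rank1 v e \<in> finrank"

lemma finrank_Kset: "T \<in> finrank \<Longrightarrow> T \<in> Kset"
  by (induction rule: finrank.induct) (auto intro: Kset_add)

lemma finrank_compose: "T \<in> finrank \<Longrightarrow> a \<in> BH \<Longrightarrow> T o\<^sub>L a \<in> finrank"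
  by (induction rule: finrank.induct) (auto intro: finrank.intros simp: compose_simps rank1_compose)

definition selfadj_proj :: "('a::chilbert \<Rightarrow>\<^sub>L 'a) \<Rightarrow> bool" where
  "selfadj_proj P \<longleftrightarrow> adjL P = P \<and> P o\<^sub>L P = P"

lemma norm_id_minus_proj:
  assumes "selfadj_proj P"
  shows "norm (id_blinfun - P) \<le> 1"
proof (rule norm_blinfun_bound)
  fix x
  have "inner (P x) (P x) = inner x (P x)"
    using adjL_inner[of P x "P x"] assms unfolding selfadj_proj_def by (metis blinfun_apply_blinfun_compose)
  then have "(norm (x - P x))\<^sup>2 = (norm x)\<^sup>2 - (norm (P x))\<^sup>2"
    by (simp add: power2_norm_eq_inner inner_simps inner_commute)
  then have "(norm (x - P x))\<^sup>2 \<le> (norm x)\<^sup>2" by simp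
  then have "norm (x - P x) \<le> norm x" by (rule power2_le_imp_le) simp
  then show "norm ((id_blinfun - P) x) \<le> 1 * norm x"
    by (simp add: blinfun.bilinear_simps)
qed simp

text \<open>Gram-Schmidt: unless \<open>P\<close> already fixes \<open>s\<close>, add the projection
  onto the normalised component \<open>u\<close> of \<open>s\<close> orthogonal to the range of
  \<open>P\<close>. As \<open>P\<close> is complex linear, its range is orthogonal to
  \<open>jmul u\<close> as well, so the vectors of \<open>S\<close> remain fixed.\<close>

lemma finrank_proj_fixing:
  fixes S :: "'a::chilbert set"
  assumes "finite S"
  shows "\<exists>P\<in>finrank. selfadj_proj P \<and> (\<forall>s\<in>S. blinfun_apply P s = s)"
  using assms
proof (induction S rule: finite_induct)
  case empty
  then show ?case by (intro bexI[of _ 0]) (auto simp: finrank.intros selfadj_proj_def compose_simps)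
next
  case (insert s S)
  then obtain P where P: "P \<in> finrank" "adjL P = P" "P o\<^sub>L P = P" and fixS: "\<And>x. x \<in> S \<Longrightarrow> P x = x"
    by (auto simp: selfadj_proj_def)
  have PB: "P \<in> BH" using P(1) finrank_Kset Kset_BH by blast
  have PP: "P (P x) = P x" for x using P(3) by (metis blinfun_apply_blinfun_compose)
  define w where "w = s - P s"
  show ?case
  proof (cases "w = 0")
    case True
    then show ?thesis using P fixS by (intro bexI[of _ P]) (auto simp: w_def selfadj_proj_def)
  next
    case False
    define u where "u = (1 / norm w) *\<^sub>R w"
    have nu: "norm u = 1" using False by (simp add: u_def)
    have Pw: "P w = 0" by (simp add: w_def blinfun.bilinear_simps PP)
    then have Pu: "P u = 0" by (simp add: u_def blinfun.bilinear_simps)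
    have orth: "inner (P x) u = 0" "inner (P x) (jmul u) = 0" for x
      using Pu BH_apply_jmul[OF PB, of u] by (auto simp: adjL_inner P(2))
    let ?P = "P + rank1 u u"
    have "adjL ?P = ?P" by (simp add: P(2))
    moreover have "?P o\<^sub>L ?P = ?P"
      by (simp add: compose_simps P(2,3) compose_rank1[OF PB] rank1_compose[OF PB] Pu rank1_rank1 nu)
    moreover have "?P x = x" if "x \<in> S" for x
      using orth[of x] fixS[OF that] by (simp add: blinfun.bilinear_simps rank1_apply)
    moreover have "?P s = s"
    proof -
      have wu: "norm w *\<^sub>R u = w" using False by (simp add: u_def)
      have "inner (norm w *\<^sub>R u) u = norm w" "inner (norm w *\<^sub>R u) (jmul u) = 0"
        using nu by (simp_all flip: power2_norm_eq_inner)
      then have "inner w u = norm w" "inner w (jmul u) = 0" by (simp_all only: wu)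
      with orth[of s] have "inner s u = norm w" "inner s (jmul u) = 0"
        by (auto simp: w_def inner_simps)
      then show ?thesis by (simp add: blinfun.bilinear_simps rank1_apply wu) (simp add: w_def)
    qed
    ultimately show ?thesis using P(1) by (intro bexI[of _ ?P]) (auto simp: finrank.intros selfadj_proj_def)
  qed
qed

text \<open>The factor 2 comes from rescaling \<open>x\<close> to norm 1/2, inside the open ball; it
  is harmless in the epsilon arguments that follow.\<close>

lemma norm_le_of_unit_ball:
  assumes "\<And>x. norm x < 1 \<Longrightarrow> norm (blinfun_apply T x) \<le> c"
  shows "norm T \<le> 2 * c"
proof (rule norm_blinfun_bound)
  have "0 \<le> c" using assms[of 0] by simp
  then show "0 \<le> 2 * c" by simp
  fix x
  show "norm (T x) \<le> 2 * c * norm x"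
  proof (cases "x = 0")
    case False
    with assms[of "(1 / (2 * norm x)) *\<^sub>R x"] show ?thesis
      by (simp add: blinfun.bilinear_simps field_simps)
  qed (simp add: blinfun.bilinear_simps)
qed

lemma Kset_finite_net:
  assumes "k \<in> Kset" "e > 0"
  obtains S where "finite S" "\<And>x. norm x < 1 \<Longrightarrow> \<exists>s\<in>S. norm (blinfun_apply k x - s) < e"
proof -
  have "compact (closure (k ` ball 0 1))" using assms by (simp add: Kset_def compact_op_def)
  then obtain S where S: "finite S" "closure (k ` ball 0 1) \<subseteq> (\<Union>x\<in>S. ball x e)"
    using assms(2) unfolding compact_eq_totally_bounded by meson
  show thesis
  proof (rule that[OF S(1)])
    fix x :: 'a assume "norm x < 1"
    then show "\<exists>s\<in>S. norm (k x - s) < e" using S(2) compact_op_mem[of x k]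
      by (force simp: dist_norm norm_minus_commute)
  qed
qed

text \<open>\<open>P\<close> fixes a finite net of the image of the unit ball, so the contraction
  \<open>id_blinfun - P\<close> kills the net and leaves only the small distances to it.\<close>

lemma Kset_finrank_approx:
  assumes "k \<in> Kset" "e > 0"
  shows "\<exists>P\<in>finrank. selfadj_proj P \<and> norm (k - (P o\<^sub>L k)) \<le> e"
proof -
  obtain S where S: "finite S" "\<And>x. norm x < 1 \<Longrightarrow> \<exists>s\<in>S. norm (k x - s) < e/2"
    using Kset_finite_net[OF assms(1), of "e/2"] assms(2) by auto
  obtain P where P: "P \<in> finrank" "selfadj_proj P" "\<forall>s\<in>S. P s = s"
    using finrank_proj_fixing[OF S(1)] by blast
  have "norm (k - (P o\<^sub>L k)) \<le> 2 * (e/2)"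
  proof (rule norm_le_of_unit_ball)
    fix x :: 'a assume "norm x < 1"
    then obtain s where s: "s \<in> S" "norm (k x - s) < e/2" using S(2) by blast
    have "(k - (P o\<^sub>L k)) x = (id_blinfun - P) (k x - s)"
      using P(3) s(1) by (simp add: blinfun.bilinear_simps)
    also have "norm \<dots> \<le> norm (id_blinfun - P) * norm (k x - s)" by (rule norm_blinfun)
    also have "\<dots> \<le> 1 * norm (k x - s)" by (intro mult_right_mono norm_id_minus_proj P) auto
    finally show "norm ((k - (P o\<^sub>L k)) x) \<le> e/2" using s by simp
  qed
  then show ?thesis using P by auto
qed

text \<open>The \<open>S n\<close> are uniformly Lipschitz, so their pointwise convergence is
  uniform on the totally bounded image of the unit ball under \<open>k\<close>.\<close>

lemma strong_null_compose_compact: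
  assumes k: "k \<in> Kset" and S1: "\<And>n. norm (S n) \<le> 1"
    and S0: "\<And>x. (\<lambda>n. blinfun_apply (S n) x) \<longlonglongrightarrow> 0"
  shows "(\<lambda>n. S n o\<^sub>L k) \<longlonglongrightarrow> 0"
proof (rule tendstoI)
  fix e :: real assume e: "e > 0"
  \<comment> \<open>Two errors of \<open>e/5\<close> and the factor 2 of
    \<open>norm_le_of_unit_ball\<close> add up to \<open>4 * e / 5\<close>, strictly below
    \<open>e\<close>.\<close>
  obtain F where F: "finite F" "\<And>x. norm x < 1 \<Longrightarrow> \<exists>s\<in>F. norm (k x - s) < e/5"
    using Kset_finite_net[OF k, of "e/5"] e by auto
  have "\<forall>\<^sub>F n in sequentially. \<forall>s\<in>F. norm (S n s) < e/5"
  proof (intro eventually_ball_finite ballI F(1))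
    fix s
    show "\<forall>\<^sub>F n in sequentially. norm (S n s) < e/5"
      using tendstoD[OF S0[of s], of "e/5"] e by (simp add: dist_norm)
  qed
  then show "\<forall>\<^sub>F n in sequentially. dist (S n o\<^sub>L k) 0 < e"
  proof eventually_elim
    case (elim n)
    have "norm (S n o\<^sub>L k) \<le> 2 * (2 * e/5)"
    proof (rule norm_le_of_unit_ball)
      fix x :: 'a assume "norm x < 1"
      then obtain s where s: "s \<in> F" "norm (k x - s) < e/5" using F(2) by blast
      have "(S n o\<^sub>L k) x = S n (k x - s) + S n s" by (simp add: blinfun.bilinear_simps)
      also have "norm \<dots> \<le> norm (S n (k x - s)) + norm (S n s)" by (rule norm_triangle_ineq)
      also have "norm (S n (k x - s)) \<le> norm (S n) * norm (k x - s)" by (rule norm_blinfun)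
      also have "\<dots> \<le> 1 * norm (k x - s)" by (intro mult_right_mono S1) auto
      finally show "norm ((S n o\<^sub>L k) x) \<le> 2 * e/5" using s elim by force
    qed
    then show ?case using e by (simp add: dist_norm)
  qed
qed

section \<open>Pure states\<close>

text \<open>The discriminant criterion, from the vertex \<open>s = - B / C\<close>; for
  \<open>C = 0\<close> the function is affine, and nonnegativity forces
  \<open>B = 0\<close>.\<close>

lemma square_le_of_quadratic_nonneg:
  fixes A B C :: real
  assumes "\<And>s. 0 \<le> A + 2 * s * B + s\<^sup>2 * C" "0 \<le> C"
  shows "B\<^sup>2 \<le> A * C"
proof (cases "C = 0")
  case True
  have "B = 0"
  proof (rule ccontr)
    assume "B \<noteq> 0"
    then show False using assms(1)[of "- (A + 1) / (2 * B)"] True by (simp add: field_simps)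
  qed
  then show ?thesis using True by simp
next
  case False
  then have C: "C > 0" using assms(2) by simp
  have "A + 2 * (- B / C) * B + (- B / C)\<^sup>2 * C = (A * C - B\<^sup>2) / C"
    using C by (simp add: field_simps power2_eq_square)
  with assms(1)[of "- B / C"] C show ?thesis by (simp add: zero_le_divide_iff)
qed

lemma bounded_linear_adjL: "bounded_linear (adjL :: ('a::chilbert \<Rightarrow>\<^sub>L 'a) \<Rightarrow> _)"
  by (rule bounded_linear_intro[where K=1]) simp_all

instance chilbert \<subseteq> banach ..

locale cstar_extension =
  fixes AA :: "('h::chilbert \<Rightarrow>\<^sub>L 'h) set"
  assumes cstar: "unital_cstar_subalg AA"
    and K_sub: "Kset \<subseteq> AA"
    and comm: "\<And>a b. a \<in> AA \<Longrightarrow> b \<in> AA \<Longrightarrow> (a o\<^sub>L b) - (b o\<^sub>L a) \<in> Kset"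
begin

lemma AA_BH: "a \<in> AA \<Longrightarrow> a \<in> BH"
  and AA_add: "a \<in> AA \<Longrightarrow> b \<in> AA \<Longrightarrow> a + b \<in> AA"
  and AA_cscaleL: "a \<in> AA \<Longrightarrow> cscaleL c a \<in> AA"
  and AA_compose: "a \<in> AA \<Longrightarrow> b \<in> AA \<Longrightarrow> a o\<^sub>L b \<in> AA"
  and AA_id: "id_blinfun \<in> AA"
  and AA_zero: "0 \<in> AA"
  and AA_adjL: "a \<in> AA \<Longrightarrow> adjL a \<in> AA"
  and AA_closed: "closed AA"
  using cstar unfolding unital_cstar_subalg_def unital_closed_subalg_def complex_subspace_def by auto

lemma AA_scaleR: "a \<in> AA \<Longrightarrow> r *\<^sub>R a \<in> AA"
  using AA_cscaleL[of a "of_real r"] by (simp add: cscaleL_simps)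

lemma AA_minus: "a \<in> AA \<Longrightarrow> - a \<in> AA"
  using AA_scaleR[of a "-1"] by simp

lemma AA_diff: "a \<in> AA \<Longrightarrow> b \<in> AA \<Longrightarrow> a - b \<in> AA"
  using AA_add[OF _ AA_minus, of a b] by simp

lemma AA_K: "k \<in> Kset \<Longrightarrow> k \<in> AA"
  using K_sub by blast

lemmas AA_intros = AA_add AA_diff AA_minus AA_scaleR AA_cscaleL AA_compose AA_id AA_zero AA_adjL AA_K

text \<open>Writing the root as \<open>1 - y\<close> turns the equation into \<open>y = (x + y\<^sup>2)/2\<close>, whose right-hand side
  is a contraction of the ball of radius \<open>\<parallel>x\<parallel>\<close>.\<close>

lemma sqrt_id_minus:
  assumes x: "x \<in> AA" "adjL x = x" "norm x < 1"
  shows "\<exists>p\<in>AA. adjL p = p \<and> p o\<^sub>L p = id_blinfun - x"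
proof -
  define q where "q = norm x"
  have q: "0 \<le> q" "q < 1" using x by (auto simp: q_def)
  define S where "S = AA \<inter> {y. adjL y = y} \<inter> cball 0 q"
  define f where "f y = (1/2) *\<^sub>R (x + (y o\<^sub>L y))" for y
  have cont: "continuous_on UNIV (adjL :: ('h \<Rightarrow>\<^sub>L 'h) \<Rightarrow> _)"
    using bounded_linear_adjL by (rule linear_continuous_on)
  have "closed S" unfolding S_def
    by (intro closed_Int AA_closed closed_cball closed_Collect_eq cont continuous_on_id)
  then have "complete S" by (simp add: complete_eq_closed)
  moreover have "S \<noteq> {}" using q AA_zero by (auto simp: S_def intro!: exI[of _ 0])
  moreover have "f ` S \<subseteq> S"
  proof
    fix z assume "z \<in> f ` S"
    then obtain y where y: "y \<in> AA" "adjL y = y" "norm y \<le> q" "z = f y" by (auto simp: S_def)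
    have "norm (y o\<^sub>L y) \<le> norm y * norm y" by (rule norm_blinfun_compose)
    also have "\<dots> \<le> q * 1" using y q by (intro mult_mono) auto
    finally have "norm (x + (y o\<^sub>L y)) \<le> q + q" using norm_triangle_ineq[of x "y o\<^sub>L y"] by (simp add: q_def)
    then have "norm z \<le> q" by (simp add: y(4) f_def)
    moreover have "z \<in> AA" unfolding y(4) f_def by (intro AA_intros x y)
    ultimately show "z \<in> S" using y x by (simp add: S_def f_def)
  qed
  moreover have "dist (f y) (f z) \<le> q * dist y z" if "y \<in> S" "z \<in> S" for y z
  proof -
    have n: "norm y \<le> q" "norm z \<le> q" using that by (auto simp: S_def)
    have "f y - f z = (1/2) *\<^sub>R ((y o\<^sub>L (y - z)) + ((y - z) o\<^sub>L z))"
      by (simp add: f_def compose_simps algebra_simps)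
    moreover have "norm ((y o\<^sub>L (y - z)) + ((y - z) o\<^sub>L z)) \<le> norm y * norm (y - z) + norm (y - z) * norm z"
      by (intro norm_triangle_mono norm_blinfun_compose)
    moreover have "norm y * norm (y - z) + norm (y - z) * norm z \<le> q * norm (y - z) + norm (y - z) * q"
      by (intro add_mono mult_mono n) (use q in auto)
    ultimately show ?thesis by (simp add: dist_norm)
  qed
  ultimately obtain y where y: "y \<in> S" "f y = y" using Banach_fix[of S q f] q by blast
  have "x + (y o\<^sub>L y) = 2 *\<^sub>R y"
  proof -
    have "2 *\<^sub>R f y = x + (y o\<^sub>L y)" by (simp add: f_def)
    then show ?thesis by (simp add: y(2))
  qed
  then have "(y o\<^sub>L y) = y + y - x" by (simp add: algebra_simps scaleR_2)
  then have "(id_blinfun - y) o\<^sub>L (id_blinfun - y) = id_blinfun - x" by (simp add: compose_simps)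
  then show ?thesis using y by (intro bexI[of _ "id_blinfun - y"]) (auto simp: S_def AA_intros)
qed

section \<open>Consequences of positivity for a fixed state\<close>

context
  fixes \<psi> :: "('h \<Rightarrow>\<^sub>L 'h) \<Rightarrow> complex"
  assumes state: "state AA \<psi>"
begin

lemma state_add: "a \<in> AA \<Longrightarrow> b \<in> AA \<Longrightarrow> \<psi> (a + b) = \<psi> a + \<psi> b"
  and state_cscaleL: "a \<in> AA \<Longrightarrow> \<psi> (cscaleL c a) = c * \<psi> a"
  and state_id: "\<psi> id_blinfun = 1"
  and state_Im: "a \<in> AA \<Longrightarrow> Im (\<psi> (adjL a o\<^sub>L a)) = 0"
  and state_Re: "a \<in> AA \<Longrightarrow> 0 \<le> Re (\<psi> (adjL a o\<^sub>L a))"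
  using state by (auto simp: state_def clinear_on_def)

lemma state_scaleR: "a \<in> AA \<Longrightarrow> \<psi> (r *\<^sub>R a) = of_real r * \<psi> a"
  using state_cscaleL[of a "of_real r"] by (simp add: cscaleL_simps)

lemma state_minus: "a \<in> AA \<Longrightarrow> \<psi> (- a) = - \<psi> a"
  using state_scaleR[of a "-1"] by simp

lemma state_diff: "a \<in> AA \<Longrightarrow> b \<in> AA \<Longrightarrow> \<psi> (a - b) = \<psi> a - \<psi> b"
  using state_add[of a "- b"] by (simp add: state_minus AA_intros)

lemma state_zero: "\<psi> 0 = 0"
  using state_scaleR[OF AA_id, of 0] by simp

lemmas state_simps = state_add state_diff state_minus state_scaleR state_cscaleL state_id state_zero

text \<open>Polarisation: positivity at \<open>a + id_blinfun\<close> compares the imaginary parts,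
  and positivity at \<open>a\<close> plus \<i> times the identity compares the real parts.\<close>

lemma state_adjL:
  assumes a: "a \<in> AA"
  shows "\<psi> (adjL a) = cnj (\<psi> a)"
proof -
  note s = state_simps AA_intros a compose_simps
  have "adjL (a + id_blinfun) o\<^sub>L (a + id_blinfun) = (adjL a o\<^sub>L a) + (adjL a + (a + id_blinfun))"
    by (simp add: compose_simps algebra_simps)
  with state_Im[of "a + id_blinfun"] state_Im[OF a] have "Im (\<psi> (adjL a)) + Im (\<psi> a) = 0"
    by (simp add: s)
  moreover
  let ?i = "cscaleL \<i> id_blinfun"
  have e: "adjL (a + ?i) o\<^sub>L (a + ?i) = (adjL a o\<^sub>L a) + (cscaleL \<i> (adjL a) + (cscaleL (- \<i>) a + id_blinfun))"
    using AA_BH[OF a] by (simp add: compose_simps algebra_simps compose_cscaleL adjL_cscaleL BH_closed adjL_BH cscaleL_simps)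
  have "Im (\<psi> (adjL (a + ?i) o\<^sub>L (a + ?i))) = 0" by (intro state_Im AA_intros a)
  then have "Re (\<psi> (adjL a)) - Re (\<psi> a) = 0"
    unfolding e using state_Im[OF a] by (simp add: s)
  ultimately show ?thesis by (simp add: complex_eq_iff)
qed

text \<open>For \<open>r > norm x\<close> the element \<open>id_blinfun - (1/r) *\<^sub>R x\<close>
  is the square of a selfadjoint element of \<open>AA\<close>, hence has a nonnegative
  value.\<close>

lemma state_selfadj_le:
  assumes x: "x \<in> AA" "adjL x = x"
  shows "Re (\<psi> x) \<le> norm x"
proof (rule dense_ge)
  fix r assume r: "norm x < r"
  then have r0: "r > 0" using norm_ge_zero[of x] by linarith
  have "norm ((1/r) *\<^sub>R x) < 1" using r r0 by simp
  then obtain p where p: "p \<in> AA" "adjL p = p" "p o\<^sub>L p = id_blinfun - (1/r) *\<^sub>R x"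
    using sqrt_id_minus[of "(1/r) *\<^sub>R x"] x by (auto simp: AA_intros)
  have "0 \<le> Re (\<psi> (id_blinfun - (1/r) *\<^sub>R x))" using state_Re[OF p(1)] by (simp add: p)
  then have "Re (\<psi> x) / r \<le> 1" using x by (simp add: state_simps AA_intros)
  then show "Re (\<psi> x) \<le> r" using r0 by (simp add: field_simps)
qed

text \<open>A phase \<open>c\<close> makes the value real and nonnegative; the selfadjoint part of
  \<open>b\<close> has the same value and no larger norm, which leaves the selfadjoint case.\<close>

lemma state_bounded:
  assumes a: "a \<in> AA"
  shows "cmod (\<psi> a) \<le> norm a"
proof -
  obtain c where c: "cmod c = 1" "c * \<psi> a = of_real (cmod (\<psi> a))"
  proof (cases "\<psi> a = 0")
    case True
    then show ?thesis using that[of 1] by simp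
  next
    case False
    have "cnj (\<psi> a) * \<psi> a = of_real (cmod (\<psi> a)) * of_real (cmod (\<psi> a))"
      by (metis complex_norm_square mult.commute of_real_mult power2_eq_square)
    then show ?thesis using that[of "cnj (\<psi> a) / of_real (cmod (\<psi> a))"] False
      by (simp add: norm_divide)
  qed
  define b where "b = cscaleL c a"
  have b: "b \<in> AA" "norm b = norm a" "\<psi> b = of_real (cmod (\<psi> a))"
    using a c by (auto simp: b_def AA_intros state_simps)
  define h where "h = (1/2) *\<^sub>R (b + adjL b)"
  have h: "h \<in> AA" "adjL h = h" by (auto simp: h_def b AA_intros add.commute)
  have "\<psi> h = of_real (cmod (\<psi> a))"
    by (simp add: h_def state_simps AA_intros b state_adjL)
  then have "cmod (\<psi> a) \<le> norm h" using state_selfadj_le[OF h] by simp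
  also have "\<dots> \<le> norm a"
    using norm_triangle_ineq[of b "adjL b"] by (simp add: h_def b)
  finally show ?thesis .
qed

text \<open>Positivity along \<open>y + s *\<^sub>R x\<close> with real \<open>s\<close> sees only
  the real part of the cross term. In \<open>pure_state_vector_state\<close> that real part is a
  squared norm, so no phase has to be adjusted.\<close>

lemma state_Cauchy_Schwarz_Re:
  assumes x: "x \<in> AA" and y: "y \<in> AA"
  shows "(Re (\<psi> (adjL y o\<^sub>L x)))\<^sup>2 \<le> Re (\<psi> (adjL y o\<^sub>L y)) * Re (\<psi> (adjL x o\<^sub>L x))"
proof (rule square_le_of_quadratic_nonneg)
  fix s :: real
  let ?z = "y + s *\<^sub>R x"
  have "adjL ?z o\<^sub>L ?z = (adjL y o\<^sub>L y) + (s *\<^sub>R ((adjL y o\<^sub>L x) + adjL (adjL y o\<^sub>L x)) + (s * s) *\<^sub>R (adjL x o\<^sub>L x))"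
    by (simp add: compose_simps algebra_simps)
  then have "Re (\<psi> (adjL ?z o\<^sub>L ?z)) = Re (\<psi> (adjL y o\<^sub>L y)) + 2 * s * Re (\<psi> (adjL y o\<^sub>L x)) + s\<^sup>2 * Re (\<psi> (adjL x o\<^sub>L x))"
    using state_adjL[of "adjL y o\<^sub>L x"]
    by (simp add: state_simps AA_intros x y power2_eq_square del: adjL_simps(7))
  then show "0 \<le> Re (\<psi> (adjL y o\<^sub>L y)) + 2 * s * Re (\<psi> (adjL y o\<^sub>L x)) + s\<^sup>2 * Re (\<psi> (adjL x o\<^sub>L x))"
    using state_Re[of ?z] by (simp add: AA_intros x y)
qed (rule state_Re[OF x])

text \<open>\<open>P o\<^sub>L k\<close> is of finite rank and close to \<open>k\<close>, and states
  are contractive. Hence the case distinction of the final proof can be made on rank-one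
  operators.\<close>

lemma state_vanishes_Kset:
  assumes "\<And>v e. \<psi> (rank1 v e) = 0" and k: "k \<in> Kset"
  shows "\<psi> k = 0"
proof -
  have fin: "\<psi> T = 0" if "T \<in> finrank" for T
    using that by (induction rule: finrank.induct) (auto simp: state_simps assms(1) AA_K finrank_Kset)
  have "cmod (\<psi> k) \<le> e" if e: "e > 0" for e
  proof -
    obtain P where P: "P \<in> finrank" "norm (k - (P o\<^sub>L k)) \<le> e"
      using Kset_finrank_approx[OF k e] by blast
    have Pk: "P o\<^sub>L k \<in> finrank" by (rule finrank_compose[OF P(1) Kset_BH[OF k]])
    have "\<psi> k = \<psi> (k - (P o\<^sub>L k))"
      using fin[OF Pk] AA_K[OF k] AA_K[OF finrank_Kset[OF Pk]] by (simp add: state_diff)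
    also have "cmod \<dots> \<le> norm (k - (P o\<^sub>L k))"
      by (intro state_bounded AA_diff AA_K k finrank_Kset Pk)
    finally show ?thesis using P by simp
  qed
  then have "cmod (\<psi> k) \<le> 0" by (rule field_le_epsilon) simp
  then show ?thesis by simp
qed

end

text \<open>The complex inner product of \<open>a u\<close> and \<open>u\<close>, in the convention
  of \<open>rank1\<close>.\<close>

definition vector_state :: "'h \<Rightarrow> ('h \<Rightarrow>\<^sub>L 'h) \<Rightarrow> complex" where
  "vector_state u a = Complex (inner (blinfun_apply a u) u) (inner (blinfun_apply a u) (jmul u))"

lemma vector_state_pos:
  assumes "a \<in> AA"
  shows "vector_state u (adjL a o\<^sub>L a) = of_real ((norm (blinfun_apply a u))\<^sup>2)"
  using AA_BH[OF assms]
  by (simp add: vector_state_def complex_eq_iff adjL_inner BH_apply_jmul power2_norm_eq_inner flip: adjL_inner')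

lemma state_vector_state:
  assumes "norm u = 1"
  shows "state AA (vector_state u)"
  unfolding state_def clinear_on_def
proof (intro conjI ballI allI)
  fix a b and c :: complex
  show "vector_state u (a + b) = vector_state u a + vector_state u b"
    by (simp add: vector_state_def complex_eq_iff inner_simps blinfun.bilinear_simps)
  show "vector_state u (cscaleL c a) = c * vector_state u a"
    by (simp add: vector_state_def complex_eq_iff inner_simps cscaleL_apply jmul_skew jmul_jmul)
  assume "a \<in> AA"
  then show "Im (vector_state u (adjL a o\<^sub>L a)) = 0" "0 \<le> Re (vector_state u (adjL a o\<^sub>L a))"
    by (simp_all add: vector_state_pos)
next
  show "vector_state u id_blinfun = 1"
    using assms by (simp add: vector_state_def complex_eq_iff flip: power2_norm_eq_inner)
qed

text \<open>If a multiple of \<psi> dominates \<phi>, then \<psi> is a proper convex combination of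
  \<phi> and the normalised remainder \<open>\<phi>2\<close>, and purity applies.\<close>

lemma pure_state_dominating:
  assumes pure: "pure_state AA \<psi>" and \<phi>: "state AA \<phi>" and C: "C > 0"
    and dom: "\<And>a. a \<in> AA \<Longrightarrow> Re (\<phi> (adjL a o\<^sub>L a)) \<le> C * Re (\<psi> (adjL a o\<^sub>L a))"
    and a: "a \<in> AA"
  shows "\<psi> a = \<phi> a"
proof -
  have \<psi>: "state AA \<psi>" using pure by (simp add: pure_state_def)
  \<comment> \<open>The bound \<open>1/C\<close> makes the remainder positive; the bound
    \<open>1/2\<close> keeps \<open>l\<close> below 1, so that division by \<open>1 - l\<close> is
    legitimate.\<close>
  define l where "l = min (1/2) (1/C)"
  have l: "0 < l" "l < 1" "l \<le> 1 / C" using C by (auto simp: l_def)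
  have "complex_of_real (1 - l) \<noteq> 0" unfolding of_real_eq_0_iff using l by simp
  then have nz: "1 - complex_of_real l \<noteq> 0" by simp
  define \<phi>2 where "\<phi>2 a = (\<psi> a - of_real l * \<phi> a) / of_real (1 - l)" for a
  have "state AA \<phi>2" unfolding state_def clinear_on_def
  proof (intro conjI ballI allI)
    fix a b and c :: complex assume ab: "a \<in> AA"
    show "b \<in> AA \<Longrightarrow> \<phi>2 (a + b) = \<phi>2 a + \<phi>2 b" using ab
      by (simp add: \<phi>2_def state_add[OF \<psi>] state_add[OF \<phi>] add_divide_distrib diff_divide_distrib distrib_left)
    show "\<phi>2 (cscaleL c a) = c * \<phi>2 a" using ab
      by (simp add: \<phi>2_def state_cscaleL[OF \<psi>] state_cscaleL[OF \<phi>] algebra_simps diff_divide_distrib)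
    have e: "\<phi>2 (adjL a o\<^sub>L a) = of_real ((Re (\<psi> (adjL a o\<^sub>L a)) - l * Re (\<phi> (adjL a o\<^sub>L a))) / (1 - l))"
    proof -
      have "\<psi> (adjL a o\<^sub>L a) = of_real (Re (\<psi> (adjL a o\<^sub>L a)))" "\<phi> (adjL a o\<^sub>L a) = of_real (Re (\<phi> (adjL a o\<^sub>L a)))"
        using state_Im[OF \<psi> ab] state_Im[OF \<phi> ab] by (simp_all add: complex_eq_iff)
      then have "\<phi>2 (adjL a o\<^sub>L a) = (of_real (Re (\<psi> (adjL a o\<^sub>L a))) - of_real l * of_real (Re (\<phi> (adjL a o\<^sub>L a)))) / of_real (1 - l)"
        unfolding \<phi>2_def by metis
      then show ?thesis by simp
    qed
    have "l * Re (\<phi> (adjL a o\<^sub>L a)) \<le> 1 / C * (C * Re (\<psi> (adjL a o\<^sub>L a)))"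
      by (intro mult_mono l dom ab state_Re[OF \<phi>]) (use C in auto)
    then show "Im (\<phi>2 (adjL a o\<^sub>L a)) = 0" "0 \<le> Re (\<phi>2 (adjL a o\<^sub>L a))"
      unfolding e using C l by auto
  next
    show "\<phi>2 id_blinfun = 1" using nz by (simp add: \<phi>2_def state_id[OF \<psi>] state_id[OF \<phi>])
  qed
  moreover have "\<forall>a\<in>AA. \<psi> a = of_real l * \<phi> a + of_real (1 - l) * \<phi>2 a"
    using nz by (simp add: \<phi>2_def)
  ultimately have "\<forall>a\<in>AA. \<phi> a = \<psi> a"
    using pure \<phi> l unfolding pure_state_def by blast
  then show ?thesis using a by simp
qed

text \<open>The functional \<open>v \<mapsto> \<psi>(v \<otimes> e\<^sup>*)\<close> is represented by a vector \<open>\<xi>\<close>, and the Cauchy-Schwarz inequality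
  for \<open>\<psi>(a (v \<otimes> e\<^sup>*)) = \<langle>a v, \<xi>\<rangle>\<close> at \<open>v = a\<^sup>* \<xi>\<close> shows that \<open>\<psi>\<close> dominates a multiple of the
  vector functional at \<open>\<xi>\<close>.\<close>

lemma pure_state_vector_state:
  assumes pure: "pure_state AA \<psi>" and nz: "\<psi> (rank1 v e) \<noteq> 0"
  shows "\<exists>u. norm u = 1 \<and> (\<forall>a\<in>AA. \<psi> a = vector_state u a)"
proof -
  have \<psi>: "state AA \<psi>" using pure by (simp add: pure_state_def)
  note s = state_simps[OF \<psi>] AA_K
  have "bounded_linear (\<lambda>w. Re (\<psi> (rank1 w e)))"
  proof (rule bounded_linear_intro[where K="norm e"])
    fix w
    have "\<bar>Re (\<psi> (rank1 w e))\<bar> \<le> cmod (\<psi> (rank1 w e))" by (rule abs_Re_le_cmod)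
    also have "\<dots> \<le> norm (rank1 w e)" by (intro state_bounded[OF \<psi>] AA_K rank1_Kset)
    also have "\<dots> \<le> norm w * norm e" by (rule norm_rank1_le)
    finally show "norm (Re (\<psi> (rank1 w e))) \<le> norm w * norm e" by simp
  qed (simp_all add: rank1_add rank1_scaleR s)
  then obtain \<xi> where \<xi>: "\<And>w. Re (\<psi> (rank1 w e)) = inner w \<xi>"
    using riesz_representation_real by blast
  have "\<xi> \<noteq> 0"
  proof
    assume "\<xi> = 0"
    \<comment> \<open>The value at \<open>jmul v\<close> is \<i> times the value at
      \<open>v\<close>, so these two real parts together are the whole complex number.\<close>
    then have "Re (\<psi> (rank1 v e)) = 0" "Re (\<psi> (rank1 (jmul v) e)) = 0" using \<xi> by auto
    then show False using nz by (simp add: rank1_jmul s complex_eq_iff)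
  qed
  define C where "C = Re (\<psi> (rank1 e e))"
  have bound: "(norm (adjL a \<xi>))\<^sup>2 * (norm (adjL a \<xi>))\<^sup>2 \<le> (norm (adjL a \<xi>))\<^sup>2 * (C * Re (\<psi> (a o\<^sub>L adjL a)))"
    if a: "a \<in> AA" for a
  proof -
    let ?w = "adjL a \<xi>"
    have "Re (\<psi> (a o\<^sub>L rank1 ?w e)) = (norm ?w)\<^sup>2"
      by (simp add: compose_rank1 AA_BH a \<xi> adjL_inner power2_norm_eq_inner)
    then have "((norm ?w)\<^sup>2)\<^sup>2 \<le> Re (\<psi> (a o\<^sub>L adjL a)) * Re (\<psi> (adjL (rank1 ?w e) o\<^sub>L rank1 ?w e))"
      using state_Cauchy_Schwarz_Re[OF \<psi>, of "rank1 ?w e" "adjL a"] a by (simp add: AA_intros)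
    also have "\<dots> = (norm ?w)\<^sup>2 * (C * Re (\<psi> (a o\<^sub>L adjL a)))"
      by (simp add: rank1_rank1 s C_def)
    finally show ?thesis by (simp add: power2_eq_square)
  qed
  \<comment> \<open>At the identity \<psi> takes the value 1, and \<open>bound\<close> gives the
    squared norm of \<open>\<xi>\<close> as a lower bound for \<open>C\<close>.\<close>
  have C: "C > 0"
  proof -
    have n: "(norm \<xi>)\<^sup>2 > 0" using \<open>\<xi> \<noteq> 0\<close> by simp
    have "(norm \<xi>)\<^sup>2 * (norm \<xi>)\<^sup>2 \<le> (norm \<xi>)\<^sup>2 * C" using bound[OF AA_id] by (simp add: compose_simps s)
    then have "(norm \<xi>)\<^sup>2 \<le> C" by (simp only: mult_le_cancel_left_pos[OF n])
    then show ?thesis using n by linarith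
  qed
  have bound': "(norm (a \<xi>))\<^sup>2 \<le> C * Re (\<psi> (adjL a o\<^sub>L a))" if a: "a \<in> AA" for a
  proof (cases "a \<xi> = 0")
    case True
    then show ?thesis using state_Re[OF \<psi> a] C by simp
  next
    case False
    then have n: "(norm (a \<xi>))\<^sup>2 > 0" by simp
    show ?thesis using bound[OF AA_adjL[OF a]] by (simp only: adjL_simps mult_le_cancel_left_pos[OF n])
  qed
  define u where "u = (1 / norm \<xi>) *\<^sub>R \<xi>"
  have u: "norm u = 1" using \<open>\<xi> \<noteq> 0\<close> by (simp add: u_def)
  have "\<psi> a = vector_state u a" if a: "a \<in> AA" for a
  proof (rule pure_state_dominating[OF pure state_vector_state[OF u] _ _ a])
    show "0 < C / (norm \<xi>)\<^sup>2" using C \<open>\<xi> \<noteq> 0\<close> by simp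
    fix b assume b: "b \<in> AA"
    have "(norm (b u))\<^sup>2 = (norm (b \<xi>))\<^sup>2 / (norm \<xi>)\<^sup>2"
      by (simp add: u_def blinfun.bilinear_simps power_divide)
    also have "\<dots> \<le> C * Re (\<psi> (adjL b o\<^sub>L b)) / (norm \<xi>)\<^sup>2"
      by (intro divide_right_mono bound' b) auto
    finally show "Re (vector_state u (adjL b o\<^sub>L b)) \<le> C / (norm \<xi>)\<^sup>2 * Re (\<psi> (adjL b o\<^sub>L b))"
      by (simp add: vector_state_pos b)
  qed
  then show ?thesis using u by blast
qed

text \<open>Compression by the projection onto \<open>u\<close> turns \<open>a\<close> into
  \<open>\<psi> a\<close> times that projection, so the limsup condition holds with
  equality.\<close>

lemma characteristic_sequence_vector_state:
  assumes u: "norm u = 1" and \<psi>: "\<And>a. a \<in> AA \<Longrightarrow> \<psi> a = vector_state u a"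
  shows "characteristic_sequence AA \<psi> (\<lambda>n. rank1 u u)"
proof -
  let ?P = "rank1 u u"
  have uu: "inner u u = 1" using u by (simp flip: power2_norm_eq_inner)
  have Pu: "?P u = u" by (simp add: rank1_apply uu)
  have "norm (?P u) \<le> norm ?P * norm u" by (rule norm_blinfun)
  then have nP: "norm ?P = 1" using norm_rank1_le[of u u] by (simp add: Pu u)
  have "\<psi> ?P = 1" by (simp add: \<psi> AA_K vector_state_def Pu uu complex_eq_iff)
  moreover have "adjL ?P o\<^sub>L a o\<^sub>L ?P = cscaleL (\<psi> a) ?P" if a: "a \<in> AA" for a
  proof (rule blinfun_eqI)
    fix x
    show "(adjL ?P o\<^sub>L a o\<^sub>L ?P) x = cscaleL (\<psi> a) ?P x"
      using BH_apply_jmul[OF AA_BH[OF a]]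
      by (simp add: \<psi> a vector_state_def cscaleL_apply rank1_apply blinfun.bilinear_simps inner_simps
          jmul_simps jmul_skew algebra_simps)
  qed
  ultimately show ?thesis
    unfolding characteristic_sequence_def by (simp add: AA_K nP Limsup_const)
qed

text \<open>For selfadjoint \<open>x\<close> of norm below 1, let \<open>p\<close> and
  \<open>q\<close> be roots of 1 - x and 1 + x. Compressing by \<open>p\<close> and by
  \<open>q\<close> gives two positive functionals with mean \<psi>, since \<psi> does not see
  commutators. Purity makes each proportional to \<psi>, which is multiplicativity at
  \<open>x\<close>. Scaling and the splitting of \<open>b\<close> into real and imaginary parts do
  the rest.\<close>

lemma pure_state_multiplicative:
  assumes pure: "pure_state AA \<psi>" and kill: "\<And>k. k \<in> Kset \<Longrightarrow> \<psi> k = 0"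
    and a: "a \<in> AA" and b: "b \<in> AA"
  shows "\<psi> (a o\<^sub>L b) = \<psi> a * \<psi> b"
proof -
  have \<psi>: "state AA \<psi>" using pure by (simp add: pure_state_def)
  note s = state_simps[OF \<psi>]
  have conj: "state AA (\<lambda>a. \<psi> (p o\<^sub>L a o\<^sub>L p) / of_real r)"
    if p: "p \<in> AA" "adjL p = p" "\<psi> (p o\<^sub>L p) = of_real r" "r > 0" for p r
    unfolding state_def clinear_on_def
  proof (intro conjI ballI allI)
    fix a b and c :: complex assume a: "a \<in> AA"
    show "b \<in> AA \<Longrightarrow> \<psi> (p o\<^sub>L (a + b) o\<^sub>L p) / of_real r = \<psi> (p o\<^sub>L a o\<^sub>L p) / of_real r + \<psi> (p o\<^sub>L b o\<^sub>L p) / of_real r"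
      using p a by (simp add: compose_simps s AA_intros add_divide_distrib)
    show "\<psi> (p o\<^sub>L cscaleL c a o\<^sub>L p) / of_real r = c * (\<psi> (p o\<^sub>L a o\<^sub>L p) / of_real r)"
      using p a AA_BH[OF p(1)] by (simp add: compose_cscaleL s AA_intros)
    have "p o\<^sub>L (adjL a o\<^sub>L a) o\<^sub>L p = adjL (a o\<^sub>L p) o\<^sub>L (a o\<^sub>L p)" using p by (simp add: compose_simps)
    then show "Im (\<psi> (p o\<^sub>L (adjL a o\<^sub>L a) o\<^sub>L p) / of_real r) = 0"
      "0 \<le> Re (\<psi> (p o\<^sub>L (adjL a o\<^sub>L a) o\<^sub>L p) / of_real r)"
      using state_Im[OF \<psi>, of "a o\<^sub>L p"] state_Re[OF \<psi>, of "a o\<^sub>L p"] p a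
      by (simp_all only: Im_divide_of_real Re_divide_of_real AA_intros) auto
  next
    show "\<psi> (p o\<^sub>L id_blinfun o\<^sub>L p) / of_real r = 1" using p by (simp add: compose_simps)
  qed
  have swap: "\<psi> (p o\<^sub>L a o\<^sub>L p) = \<psi> (a o\<^sub>L (p o\<^sub>L p))" if "p \<in> AA" "a \<in> AA" for p a
  proof -
    have "(p o\<^sub>L a o\<^sub>L p) - (a o\<^sub>L (p o\<^sub>L p)) = ((p o\<^sub>L a) - (a o\<^sub>L p)) o\<^sub>L p" by (simp add: compose_simps)
    also have "\<dots> \<in> Kset" by (intro Kset_compose_right comm AA_BH that)
    finally have "\<psi> ((p o\<^sub>L a o\<^sub>L p) - (a o\<^sub>L (p o\<^sub>L p))) = 0" by (rule kill)
    then show ?thesis using that by (simp add: s AA_intros)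
  qed
  have small: "\<psi> (a o\<^sub>L x) = \<psi> a * \<psi> x" if x: "x \<in> AA" "adjL x = x" "norm x < 1" for x
  proof -
    obtain p where p: "p \<in> AA" "adjL p = p" "p o\<^sub>L p = id_blinfun - x" using sqrt_id_minus x by blast
    obtain q where q: "q \<in> AA" "adjL q = q" "q o\<^sub>L q = id_blinfun + x"
      using sqrt_id_minus[of "- x"] x by (auto simp: AA_intros)
    define y where "y = Re (\<psi> x)"
    have y: "\<psi> x = of_real y" using state_adjL[OF \<psi> x(1)] x(2) by (simp add: y_def complex_eq_iff)
    have "\<bar>y\<bar> < 1" using state_bounded[OF \<psi> x(1)] x(3) by (simp add: y)
    then have y1: "1 - y > 0" "1 + y > 0" by auto
    \<comment> \<open>The weights are half the values of \<psi> at 1 - x and 1 + x, so they cancel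
      the normalisations of the two states.\<close>
    define l where "l = (1 - y) / 2"
    have l: "0 < l" "l < 1" using y1 by (auto simp: l_def)
    let ?\<phi>1 = "\<lambda>a. \<psi> (p o\<^sub>L a o\<^sub>L p) / of_real (1 - y)"
    let ?\<phi>2 = "\<lambda>a. \<psi> (q o\<^sub>L a o\<^sub>L q) / of_real (1 + y)"
    have "state AA ?\<phi>1" by (rule conj) (use p y1 x in \<open>simp_all add: s y AA_intros\<close>)
    moreover have "state AA ?\<phi>2" by (rule conj) (use q y1 x in \<open>simp_all add: s y AA_intros\<close>)
    moreover have "\<forall>a\<in>AA. \<psi> a = of_real l * ?\<phi>1 a + of_real (1 - l) * ?\<phi>2 a"
    proof
      fix a assume a: "a \<in> AA"
      have "of_real l * ?\<phi>1 a + of_real (1 - l) * ?\<phi>2 a = (\<psi> (p o\<^sub>L a o\<^sub>L p) + \<psi> (q o\<^sub>L a o\<^sub>L q)) / 2"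
      proof -
        have 1: "of_real l = of_real (1 - y) / (2::complex)" "of_real (1 - l) = of_real (1 + y) / (2::complex)"
          by (simp_all add: l_def field_simps)
        have "of_real (1 - y) \<noteq> (0::complex)" "of_real (1 + y) \<noteq> (0::complex)"
          using y1 by (simp_all only: of_real_eq_0_iff)
        then show ?thesis unfolding 1 by (simp add: add_divide_distrib del: of_real_diff of_real_add)
      qed
      also have "\<dots> = \<psi> a"
        unfolding swap[OF p(1) a] swap[OF q(1) a] p(3) q(3) using a x by (simp add: compose_simps s AA_intros)
      finally show "\<psi> a = of_real l * ?\<phi>1 a + of_real (1 - l) * ?\<phi>2 a" by simp
    qed
    ultimately have "\<forall>a\<in>AA. ?\<phi>1 a = \<psi> a"
      using pure l unfolding pure_state_def by blast
    then have "\<psi> (p o\<^sub>L a o\<^sub>L p) = \<psi> a * of_real (1 - y)"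
      using a y1 by (auto simp: field_simps simp del: of_real_diff)
    then show ?thesis unfolding swap[OF p(1) a] p(3)
      using a x by (simp add: compose_simps s AA_intros y algebra_simps)
  qed
  have sa: "\<psi> (a o\<^sub>L x) = \<psi> a * \<psi> x" if x: "x \<in> AA" "adjL x = x" for x
  proof -
    define r where "r = 1 / (norm x + 1)"
    have r: "r > 0" "norm (r *\<^sub>R x) < 1" by (auto simp: r_def add_nonneg_pos divide_simps)
    then show ?thesis using small[of "r *\<^sub>R x"] x a by (simp add: compose_simps s AA_intros)
  qed
  define h1 where "h1 = (1/2) *\<^sub>R (b + adjL b)"
  define h2 where "h2 = cscaleL (- \<i> / 2) (b - adjL b)"
  have h1: "h1 \<in> AA" "adjL h1 = h1" unfolding h1_def by (intro AA_scaleR AA_add AA_adjL b) (simp add: add.commute)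
  have h2: "h2 \<in> AA" "adjL h2 = h2"
  proof -
    have bb: "b - adjL b \<in> BH" by (intro AA_BH AA_diff AA_adjL b)
    have "adjL h2 = cscaleL (\<i> / 2) (- (b - adjL b))" by (simp add: h2_def adjL_cscaleL[OF bb])
    also have "\<dots> = h2" unfolding h2_def
      by (rule blinfun_eqI) (simp add: cscaleL_apply blinfun.bilinear_simps jmul_simps algebra_simps)
    finally show "adjL h2 = h2" .
  qed (unfold h2_def, intro AA_cscaleL AA_diff AA_adjL b)
  have ih2: "cscaleL \<i> h2 = (1/2) *\<^sub>R (b - adjL b)"
    using cscaleL_simps(5)[of "1/2" "b - adjL b"] by (simp add: h2_def cscaleL_simps(4))
  have bh: "b = h1 + cscaleL \<i> h2"
    unfolding ih2 h1_def by (simp flip: scaleR_add_right scaleR_2)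
  show ?thesis using h1 h2 a AA_BH[OF a]
    by (simp add: bh compose_simps compose_cscaleL s AA_intros sa algebra_simps)
qed

end

section \<open>Power-multiplicative seminorms modulo the compact operators\<close>

primrec opow :: "('a::real_normed_vector \<Rightarrow>\<^sub>L 'a) \<Rightarrow> nat \<Rightarrow> ('a \<Rightarrow>\<^sub>L 'a)" where
  "opow a 0 = id_blinfun"
| "opow a (Suc n) = a o\<^sub>L opow a n"

lemma opow_add: "opow a (m + n) = opow a m o\<^sub>L opow a n"
  by (induction m) (auto simp: compose_simps)

lemma opow_Suc_right: "opow a (Suc n) = opow a n o\<^sub>L a"
  using opow_add[of a n 1] by (simp add: compose_simps)

lemma norm_opow_le:
  assumes "norm a \<le> 1"
  shows "norm (opow a n) \<le> 1"
proof (induction n)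
  case (Suc n)
  have "norm (a o\<^sub>L opow a n) \<le> norm a * norm (opow a n)" by (rule norm_blinfun_compose)
  also have "\<dots> \<le> 1 * 1" by (intro mult_mono assms Suc) auto
  finally show ?case by simp
qed (simp add: norm_blinfun_id_le)

context cstar_extension
begin

lemma AA_opow: "a \<in> AA \<Longrightarrow> opow a n \<in> AA"
  by (induction n) (auto intro: AA_id AA_compose)

text \<open>The quotient norm modulo compact operators, kept as a function on operators so that no
  quotient algebra has to be formed.\<close>

definition qnorm :: "('h \<Rightarrow>\<^sub>L 'h) \<Rightarrow> real" where
  "qnorm x = (INF k\<in>Kset. norm (x + k))"

lemma qnorm_le: "k \<in> Kset \<Longrightarrow> qnorm x \<le> norm (x + k)"
  unfolding qnorm_def by (rule cINF_lower) (auto intro: bdd_belowI2[where m=0])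

lemma qnorm_le_norm: "qnorm x \<le> norm x"
  using qnorm_le[of 0 x] by simp

lemma qnorm_greatest: "(\<And>k. k \<in> Kset \<Longrightarrow> c \<le> norm (x + k)) \<Longrightarrow> c \<le> qnorm x"
  unfolding qnorm_def by (rule cINF_greatest) (auto intro: Kset_zero)

lemma qnorm_nonneg: "0 \<le> qnorm x"
  by (rule qnorm_greatest) simp

lemma qnorm_lessD: "qnorm x < c \<Longrightarrow> \<exists>k\<in>Kset. norm (x + k) < c"
  using qnorm_greatest[of c x] by force

lemma qnorm_approx:
  assumes "e > 0"
  obtains k where "k \<in> Kset" "norm (x + k) < qnorm x + e"
  using qnorm_lessD[of x "qnorm x + e"] assms by auto

lemma qnorm_cong: "x - y \<in> Kset \<Longrightarrow> qnorm x = qnorm y"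
proof (rule antisym)
  assume xy: "x - y \<in> Kset"
  show "qnorm x \<le> qnorm y"
  proof (rule qnorm_greatest)
    fix k :: "'h \<Rightarrow>\<^sub>L 'h" assume "k \<in> Kset"
    then have "qnorm x \<le> norm (x + (k - (x - y)))" by (intro qnorm_le Kset_diff xy)
    then show "qnorm x \<le> norm (y + k)" by (simp add: algebra_simps)
  qed
  show "qnorm y \<le> qnorm x"
  proof (rule qnorm_greatest)
    fix k :: "'h \<Rightarrow>\<^sub>L 'h" assume "k \<in> Kset"
    then have "qnorm y \<le> norm (y + (k + (x - y)))" by (intro qnorm_le Kset_add xy)
    then show "qnorm y \<le> norm (x + k)" by (simp add: algebra_simps)
  qed
qed

lemma qnorm_add: "qnorm (x + y) \<le> qnorm x + qnorm y"
proof (rule field_le_epsilon)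
  fix e :: real assume e: "e > 0"
  obtain k where k: "k \<in> Kset" "norm (x + k) < qnorm x + e/2" using qnorm_approx[of "e/2" x] e by auto
  obtain l where l: "l \<in> Kset" "norm (y + l) < qnorm y + e/2" using qnorm_approx[of "e/2" y] e by auto
  have "qnorm (x + y) \<le> norm (x + y + (k + l))" by (intro qnorm_le Kset_add k l)
  also have "\<dots> \<le> norm (x + k) + norm (y + l)" using norm_triangle_ineq[of "x + k" "y + l"] by (simp add: algebra_simps)
  finally show "qnorm (x + y) \<le> qnorm x + qnorm y + e" using k l by simp
qed

lemma qnorm_cscaleL: "qnorm (cscaleL c x) \<le> cmod c * qnorm x"
proof (cases "c = 0")
  case True
  then show ?thesis using qnorm_le_norm[of 0] by (simp add: cscaleL_simps)
next
  case False
  have "qnorm (cscaleL c x) / cmod c \<le> qnorm x"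
  proof (rule qnorm_greatest)
    fix k :: "'h \<Rightarrow>\<^sub>L 'h" assume "k \<in> Kset"
    then have "qnorm (cscaleL c x) \<le> norm (cscaleL c x + cscaleL c k)" by (intro qnorm_le Kset_cscaleL)
    also have "\<dots> = cmod c * norm (x + k)" by (simp flip: cscaleL_simps(1))
    finally show "qnorm (cscaleL c x) / cmod c \<le> norm (x + k)" using False by (simp add: field_simps)
  qed
  then show ?thesis using False by (simp add: field_simps)
qed

lemma qnorm_compose:
  assumes x: "x \<in> AA" and y: "y \<in> AA"
  shows "qnorm (x o\<^sub>L y) \<le> qnorm x * qnorm y"
proof -
  have *: "qnorm (x o\<^sub>L y) \<le> norm (x + k) * norm (y + l)" if kl: "k \<in> Kset" "l \<in> Kset" for k l
  proof -
    have "qnorm (x o\<^sub>L y) \<le> norm ((x o\<^sub>L y) + ((x o\<^sub>L l) + (k o\<^sub>L (y + l))))"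
      by (intro qnorm_le Kset_add Kset_compose_left Kset_compose_right AA_BH AA_add x y kl AA_K)
    also have "(x o\<^sub>L y) + ((x o\<^sub>L l) + (k o\<^sub>L (y + l))) = (x + k) o\<^sub>L (y + l)" by (simp add: compose_simps)
    finally show ?thesis using norm_blinfun_compose[of "x + k" "y + l"] by linarith
  qed
  have "qnorm (x o\<^sub>L y) \<le> norm (x + k) * qnorm y" if k: "k \<in> Kset" for k
  proof (cases "norm (x + k) = 0")
    case True
    then show ?thesis using *[OF k Kset_zero] by simp
  next
    case False
    have "qnorm (x o\<^sub>L y) / norm (x + k) \<le> qnorm y"
      by (rule qnorm_greatest) (use *[OF k] False in \<open>simp add: field_simps\<close>)
    then show ?thesis using False by (simp add: field_simps)
  qed
  note ** = this
  show ?thesis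
  proof (cases "qnorm y = 0")
    case True
    then show ?thesis using **[OF Kset_zero] by simp
  next
    case False
    then have y0: "qnorm y > 0" using qnorm_nonneg[of y] by simp
    have "qnorm (x o\<^sub>L y) / qnorm y \<le> qnorm x"
      by (rule qnorm_greatest) (use ** y0 in \<open>simp add: field_simps\<close>)
    then show ?thesis using y0 by (simp add: field_simps)
  qed
qed

text \<open>Multiplying by \<open>?Q\<close>, the complement of a finite-rank projection that almost
  fixes the range of \<open>k\<close>, changes \<open>x\<close> only by a compact operator but makes
  \<open>k\<close> negligible. The operator inequality for \<open>?Q o\<^sub>L x\<close> thus
  descends to the quotient.\<close>

lemma qnorm_cstar:
  assumes x: "x \<in> AA"
  shows "(qnorm x)\<^sup>2 \<le> qnorm (x o\<^sub>L adjL x)"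
proof (rule qnorm_greatest)
  fix k :: "'h \<Rightarrow>\<^sub>L 'h" assume k: "k \<in> Kset"
  show "(qnorm x)\<^sup>2 \<le> norm ((x o\<^sub>L adjL x) + k)"
  proof (rule field_le_epsilon)
    fix e :: real assume e: "e > 0"
    obtain P where P: "P \<in> finrank" "selfadj_proj P" "norm (k - (P o\<^sub>L k)) \<le> e"
      using Kset_finrank_approx[OF k e] by blast
    let ?Q = "id_blinfun - P"
    have nQ: "norm ?Q \<le> 1" by (rule norm_id_minus_proj[OF P(2)])
    have aQ: "adjL ?Q = ?Q" using P(2) by (simp add: selfadj_proj_def)
    have "qnorm x \<le> norm (x + (- (P o\<^sub>L x)))"
      by (intro qnorm_le Kset_minus Kset_compose_right AA_BH x finrank_Kset P)
    also have "x + (- (P o\<^sub>L x)) = ?Q o\<^sub>L x" by (simp add: compose_simps)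
    finally have "(qnorm x)\<^sup>2 \<le> (norm (?Q o\<^sub>L x))\<^sup>2" using qnorm_nonneg by (rule power_mono)
    also have "\<dots> \<le> norm ((?Q o\<^sub>L x) o\<^sub>L adjL (?Q o\<^sub>L x))" by (rule norm_sq_le_norm_compose_adjL)
    also have "(?Q o\<^sub>L x) o\<^sub>L adjL (?Q o\<^sub>L x) = (?Q o\<^sub>L (((x o\<^sub>L adjL x) + k) o\<^sub>L ?Q)) - ((?Q o\<^sub>L k) o\<^sub>L ?Q)"
      using aQ by (simp only: adjL_simps(7) compose_simps) (simp add: compose_simps)
    also have "norm \<dots> \<le> norm (?Q o\<^sub>L (((x o\<^sub>L adjL x) + k) o\<^sub>L ?Q)) + norm ((?Q o\<^sub>L k) o\<^sub>L ?Q)"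
      by (rule norm_triangle_ineq4)
    also have "norm (?Q o\<^sub>L (((x o\<^sub>L adjL x) + k) o\<^sub>L ?Q)) \<le> 1 * (norm ((x o\<^sub>L adjL x) + k) * 1)"
      by (intro order_trans[OF norm_blinfun_compose] mult_mono nQ) auto
    also have "norm ((?Q o\<^sub>L k) o\<^sub>L ?Q) \<le> norm (?Q o\<^sub>L k) * 1"
      by (rule order_trans[OF norm_blinfun_compose]) (intro mult_mono nQ, auto)
    also have "?Q o\<^sub>L k = k - (P o\<^sub>L k)" by (simp add: compose_simps)
    finally show "(qnorm x)\<^sup>2 \<le> norm ((x o\<^sub>L adjL x) + k) + e" using P(3) by simp
  qed
qed

lemma qnorm_adjL:
  assumes x: "x \<in> AA"
  shows "qnorm (adjL x) = qnorm x"
proof -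
  have *: "qnorm z \<le> qnorm (adjL z)" if z: "z \<in> AA" for z
  proof (cases "qnorm z = 0")
    case True
    then show ?thesis using qnorm_nonneg by simp
  next
    case False
    then have z0: "qnorm z > 0" using qnorm_nonneg[of z] by simp
    have "qnorm z * qnorm z \<le> qnorm z * qnorm (adjL z)"
      using qnorm_cstar[OF z] qnorm_compose[OF z AA_adjL[OF z]] by (simp add: power2_eq_square)
    then show ?thesis by (simp only: mult_le_cancel_left_pos[OF z0])
  qed
  show ?thesis using *[OF x] *[OF AA_adjL[OF x]] by simp
qed

text \<open>Two uses of the C*-inequality bound the fourth power of \<open>qnorm x\<close> by the
  quotient norm of the square of \<open>?s\<close>. Modulo compact operators that square is
  \<open>x o\<^sub>L x\<close> times its own adjoint.\<close>

lemma qnorm_square: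
  assumes x: "x \<in> AA"
  shows "qnorm (x o\<^sub>L x) = (qnorm x)\<^sup>2"
proof (rule antisym)
  show "qnorm (x o\<^sub>L x) \<le> (qnorm x)\<^sup>2" using qnorm_compose[OF x x] by (simp add: power2_eq_square)
  let ?y = "adjL x" and ?s = "x o\<^sub>L adjL x"
  have y: "?y \<in> AA" and s: "?s \<in> AA" using x by (auto intro: AA_adjL AA_compose)
  have "((qnorm x)\<^sup>2)\<^sup>2 \<le> (qnorm ?s)\<^sup>2" by (intro power_mono qnorm_cstar x) auto
  also have "\<dots> \<le> qnorm (?s o\<^sub>L ?s)" using qnorm_cstar[OF s] by simp
  also have "\<dots> = qnorm ((x o\<^sub>L x) o\<^sub>L (?y o\<^sub>L ?y))"
  proof (rule qnorm_cong)
    have "(?s o\<^sub>L ?s) - ((x o\<^sub>L x) o\<^sub>L (?y o\<^sub>L ?y)) = x o\<^sub>L (((?y o\<^sub>L x) - (x o\<^sub>L ?y)) o\<^sub>L ?y)"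
      by (simp add: compose_simps)
    also have "\<dots> \<in> Kset" by (intro Kset_compose_left Kset_compose_right comm AA_BH x y)
    finally show "(?s o\<^sub>L ?s) - ((x o\<^sub>L x) o\<^sub>L (?y o\<^sub>L ?y)) \<in> Kset" .
  qed
  also have "\<dots> \<le> qnorm (x o\<^sub>L x) * qnorm (?y o\<^sub>L ?y)"
    by (intro qnorm_compose AA_compose x y)
  also have "qnorm (?y o\<^sub>L ?y) = qnorm (x o\<^sub>L x)"
    using qnorm_adjL[OF AA_compose[OF x x]] by simp
  finally have "((qnorm x)\<^sup>2)\<^sup>2 \<le> (qnorm (x o\<^sub>L x))\<^sup>2" by (simp add: power2_eq_square)
  then show "(qnorm x)\<^sup>2 \<le> qnorm (x o\<^sub>L x)" by (rule power2_le_imp_le) (rule qnorm_nonneg)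
qed

text \<open>The bound by \<open>qnorm\<close> makes \<open>p\<close> vanish on \<open>Kset\<close>,
  so \<open>p\<close> lives on the commutative quotient. \<open>G\<close> lists elements at which
  \<open>p\<close> has already been localized; carrying it along preserves this invariance under
  further localization and minimisation.\<close>

definition pm_seminorm :: "('h \<Rightarrow>\<^sub>L 'h) set \<Rightarrow> (('h \<Rightarrow>\<^sub>L 'h) \<Rightarrow> real) \<Rightarrow> bool" where
  "pm_seminorm G p \<longleftrightarrow> (\<forall>x. 0 \<le> p x) \<and> (\<forall>x. p x \<le> qnorm x) \<and>
    (\<forall>x\<in>AA. \<forall>y\<in>AA. p (x + y) \<le> p x + p y) \<and> (\<forall>c. \<forall>x\<in>AA. p (cscaleL c x) \<le> cmod c * p x) \<and>
    (\<forall>x\<in>AA. \<forall>y\<in>AA. p (x o\<^sub>L y) \<le> p x * p y) \<and> (\<forall>x\<in>AA. p (x o\<^sub>L x) = (p x)\<^sup>2) \<and>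
    p id_blinfun = 1 \<and> (\<forall>c\<in>G. \<forall>x\<in>AA. p (x o\<^sub>L c) = p x)"

text \<open>Each axiom involves at most three arguments, so the approximating sequence may depend on
  them. For the infimum of a chain, no single sequence has to converge everywhere.\<close>

lemma pm_seminorm_closed:
  assumes "\<And>F. finite F \<Longrightarrow> \<exists>P. (\<forall>n. pm_seminorm G (P n)) \<and> (\<forall>z\<in>F. (\<lambda>n::nat. P n z) \<longlonglongrightarrow> u z)"
  shows "pm_seminorm G u"
proof -
  have lim: "\<exists>P. (\<forall>n. pm_seminorm G (P n)) \<and> (\<lambda>n::nat. P n x) \<longlonglongrightarrow> u x \<and> (\<lambda>n. P n y) \<longlonglongrightarrow> u y \<and> (\<lambda>n. P n z) \<longlonglongrightarrow> u z"
    for x y z using assms[of "{x, y, z}"] by auto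
  show ?thesis unfolding pm_seminorm_def
  proof (intro conjI allI ballI)
    fix x
    obtain P where P: "\<forall>n. pm_seminorm G (P n)" "(\<lambda>n::nat. P n x) \<longlonglongrightarrow> u x" using lim by blast
    show "0 \<le> u x" by (rule LIMSEQ_le_const[OF P(2)]) (use P(1) in \<open>auto simp: pm_seminorm_def\<close>)
    show "u x \<le> qnorm x" by (rule LIMSEQ_le_const2[OF P(2)]) (use P(1) in \<open>auto simp: pm_seminorm_def\<close>)
  next
    fix x y assume xy: "x \<in> AA" "y \<in> AA"
    obtain P where P: "\<forall>n. pm_seminorm G (P n)" "(\<lambda>n::nat. P n x) \<longlonglongrightarrow> u x" "(\<lambda>n. P n y) \<longlonglongrightarrow> u y"
      "(\<lambda>n. P n (x + y)) \<longlonglongrightarrow> u (x + y)" using lim by blast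
    show "u (x + y) \<le> u x + u y"
      by (rule LIMSEQ_le[OF P(4) tendsto_add[OF P(2,3)]]) (use P(1) xy in \<open>auto simp: pm_seminorm_def\<close>)
  next
    fix x y assume xy: "x \<in> AA" "y \<in> AA"
    obtain P where P: "\<forall>n. pm_seminorm G (P n)" "(\<lambda>n::nat. P n x) \<longlonglongrightarrow> u x" "(\<lambda>n. P n y) \<longlonglongrightarrow> u y"
      "(\<lambda>n. P n (x o\<^sub>L y)) \<longlonglongrightarrow> u (x o\<^sub>L y)" using lim by blast
    show "u (x o\<^sub>L y) \<le> u x * u y"
      by (rule LIMSEQ_le[OF P(4) tendsto_mult[OF P(2,3)]]) (use P(1) xy in \<open>auto simp: pm_seminorm_def\<close>)
  next
    fix x and c :: complex assume x: "x \<in> AA"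
    obtain P where P: "\<forall>n. pm_seminorm G (P n)" "(\<lambda>n::nat. P n x) \<longlonglongrightarrow> u x"
      "(\<lambda>n. P n (cscaleL c x)) \<longlonglongrightarrow> u (cscaleL c x)" using lim by blast
    show "u (cscaleL c x) \<le> cmod c * u x"
      by (rule LIMSEQ_le[OF P(3) tendsto_mult[OF tendsto_const P(2)]]) (use P(1) x in \<open>auto simp: pm_seminorm_def\<close>)
  next
    fix x assume x: "x \<in> AA"
    obtain P where P: "\<forall>n. pm_seminorm G (P n)" "(\<lambda>n::nat. P n x) \<longlonglongrightarrow> u x"
      "(\<lambda>n. P n (x o\<^sub>L x)) \<longlonglongrightarrow> u (x o\<^sub>L x)" using lim by blast
    have "(\<lambda>n. P n (x o\<^sub>L x)) = (\<lambda>n. (P n x)\<^sup>2)" using P(1) x by (auto simp: pm_seminorm_def)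
    with P(3) show "u (x o\<^sub>L x) = (u x)\<^sup>2" using LIMSEQ_unique tendsto_power[OF P(2), of 2] by metis
  next
    obtain P where P: "\<forall>n. pm_seminorm G (P n)" "(\<lambda>n::nat. P n id_blinfun) \<longlonglongrightarrow> u id_blinfun" using lim by blast
    have "(\<lambda>n. P n id_blinfun) = (\<lambda>n. 1)" using P(1) by (auto simp: pm_seminorm_def)
    with P(2) show "u id_blinfun = 1" by (simp add: LIMSEQ_const_iff)
  next
    fix x c assume x: "c \<in> G" "x \<in> AA"
    obtain P where P: "\<forall>n. pm_seminorm G (P n)" "(\<lambda>n::nat. P n x) \<longlonglongrightarrow> u x"
      "(\<lambda>n. P n (x o\<^sub>L c)) \<longlonglongrightarrow> u (x o\<^sub>L c)" using lim by blast
    have "(\<lambda>n. P n (x o\<^sub>L c)) = (\<lambda>n. P n x)" using P(1) x by (auto simp: pm_seminorm_def)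
    with P show "u (x o\<^sub>L c) = u x" using LIMSEQ_unique by metis
  qed
qed

lemma pm_seminorm_minimal:
  assumes p0: "pm_seminorm G p0"
  shows "\<exists>p. pm_seminorm G p \<and> (\<forall>q. pm_seminorm G q \<longrightarrow> q \<le> p \<longrightarrow> q = p)"
proof -
  let ?A = "{p. pm_seminorm G p}"
  have "\<exists>m\<in>?A. \<forall>a\<in>?A. m \<ge> a \<longrightarrow> a = m"
  proof (rule predicate_Zorn)
    show "partial_order_on ?A (relation_of (\<ge>) ?A)"
      by (rule partial_order_on_relation_ofI) auto
    fix C assume C: "C \<in> Chains (relation_of (\<ge>) ?A)"
    have CA: "pm_seminorm G p" if "p \<in> C" for p
      using C that by (auto simp: Chains_def relation_of_def)
    have chain: "p \<le> q \<or> q \<le> p" if "p \<in> C" "q \<in> C" for p q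
      using C that by (auto simp: Chains_def relation_of_def)
    show "\<exists>u\<in>?A. \<forall>a\<in>C. a \<ge> u"
    proof (cases "C = {}")
      case True
      then show ?thesis using p0 by auto
    next
      case False
      define u where "u x = (INF p\<in>C. p x)" for x
      have bdd: "bdd_below ((\<lambda>p. p x) ` C)" for x
        by (rule bdd_belowI2[where m=0]) (use CA in \<open>auto simp: pm_seminorm_def\<close>)
      have ule: "u x \<le> p x" if "p \<in> C" for p x
        unfolding u_def by (rule cINF_lower[OF bdd that])
      \<comment> \<open>Of two members of a chain the smaller one serves the points of both, so one
        member works for all of \<open>F\<close>.\<close>
      have near: "\<exists>p\<in>C. \<forall>z\<in>F. p z < u z + e" if "finite F" "e > 0" for F and e :: real
        using that(1)
      proof (induction F rule: finite_induct)
        case empty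
        then show ?case using False by auto
      next
        case (insert z F)
        then obtain p where p: "p \<in> C" "\<And>z. z \<in> F \<Longrightarrow> p z < u z + e" by blast
        have "\<exists>q\<in>C. q z < u z + e"
          using cINF_less_iff[OF False bdd, of z "u z + e"] that(2) by (simp add: u_def)
        then obtain q where q: "q \<in> C" "q z < u z + e" by blast
        show ?case
        proof (cases "p \<le> q")
          case True
          then have "p z \<le> q z" by (simp add: le_fun_def)
          then show ?thesis using p q by (intro bexI[of _ p]) auto
        next
          case False
          then have "q z' \<le> p z'" for z' using chain[OF p(1) q(1)] by (auto simp: le_fun_def)
          then show ?thesis using p q by (intro bexI[of _ q]) (auto intro: le_less_trans)
        qed
      qed
      have "pm_seminorm G u"
      proof (rule pm_seminorm_closed)
        fix F :: "('h \<Rightarrow>\<^sub>L 'h) set" assume F: "finite F"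
        have "\<forall>n. \<exists>p\<in>C. \<forall>z\<in>F. p z < u z + inverse (real (Suc n))"
          by (intro allI near F) simp
        then obtain P where P: "\<And>n. P n \<in> C" "\<And>n z. z \<in> F \<Longrightarrow> P n z < u z + inverse (real (Suc n))"
          by metis
        have "(\<lambda>n. P n z) \<longlonglongrightarrow> u z" if z: "z \<in> F" for z
        proof (rule tendsto_sandwich)
          show "\<forall>\<^sub>F n in sequentially. u z \<le> P n z" using ule[OF P(1)] by simp
          show "\<forall>\<^sub>F n in sequentially. P n z \<le> u z + inverse (real (Suc n))"
            using P(2)[OF z] by (intro always_eventually allI less_imp_le)
          show "(\<lambda>n. u z + inverse (real (Suc n))) \<longlonglongrightarrow> u z"
            using tendsto_add[OF tendsto_const LIMSEQ_inverse_real_of_nat, of "u z"] by simp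
        qed simp
        then show "\<exists>P. (\<forall>n. pm_seminorm G (P n)) \<and> (\<forall>z\<in>F. (\<lambda>n::nat. P n z) \<longlonglongrightarrow> u z)"
          using CA P(1) by blast
      qed
      then show ?thesis using ule by (auto simp: le_fun_def)
    qed
  qed
  then show ?thesis by auto
qed

text \<open>The hypothesis excludes a compact identity, for which \<open>qnorm\<close> would vanish
  on \<open>AA\<close>.\<close>

lemma pm_seminorm_qnorm:
  assumes "qnorm id_blinfun = 1"
  shows "pm_seminorm {} qnorm"
  using assms by (simp add: pm_seminorm_def qnorm_nonneg qnorm_add qnorm_cscaleL qnorm_compose qnorm_square)

section \<open>Localization of a fixed seminorm\<close>

context
  fixes G :: "('h \<Rightarrow>\<^sub>L 'h) set" and p :: "('h \<Rightarrow>\<^sub>L 'h) \<Rightarrow> real"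
  assumes p: "pm_seminorm G p" and G: "G \<subseteq> AA"
begin

lemma pm_nonneg: "0 \<le> p x"
  and pm_le_qnorm: "p x \<le> qnorm x"
  and pm_add: "x \<in> AA \<Longrightarrow> y \<in> AA \<Longrightarrow> p (x + y) \<le> p x + p y"
  and pm_cscaleL_le: "x \<in> AA \<Longrightarrow> p (cscaleL c x) \<le> cmod c * p x"
  and pm_compose_le: "x \<in> AA \<Longrightarrow> y \<in> AA \<Longrightarrow> p (x o\<^sub>L y) \<le> p x * p y"
  and pm_square: "x \<in> AA \<Longrightarrow> p (x o\<^sub>L x) = (p x)\<^sup>2"
  and pm_id: "p id_blinfun = 1"
  and pm_invariant: "g \<in> G \<Longrightarrow> x \<in> AA \<Longrightarrow> p (x o\<^sub>L g) = p x"
  using p by (auto simp: pm_seminorm_def)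

lemma pm_Kset: "k \<in> Kset \<Longrightarrow> p k = 0"
  using pm_le_qnorm[of k] qnorm_le[of "- k" k] pm_nonneg[of k] by (simp add: Kset_minus)

lemma pm_le_of_diff_null:
  assumes "x \<in> AA" "y \<in> AA" "p (x - y) = 0"
  shows "p x \<le> p y"
  using pm_add[of "x - y" y] assms by (simp add: AA_diff)

lemma pm_eq_of_diff_null:
  assumes "x \<in> AA" "y \<in> AA" "p (x - y) = 0"
  shows "p x = p y"
proof (rule antisym)
  show "p x \<le> p y" by (rule pm_le_of_diff_null[OF assms])
  have "p (y - x) \<le> cmod (-1) * p (x - y)"
    using pm_cscaleL_le[of "x - y" "-1"] assms cscaleL_simps(3)[of 1 "x - y"] by (simp add: AA_diff cscaleL_simps)
  then have "p (y - x) = 0" using assms(3) pm_nonneg[of "y - x"] by simp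
  then show "p y \<le> p x" by (rule pm_le_of_diff_null[OF assms(2,1)])
qed

lemma pm_cong: "x \<in> AA \<Longrightarrow> y \<in> AA \<Longrightarrow> x - y \<in> Kset \<Longrightarrow> p x = p y"
  by (rule pm_eq_of_diff_null) (auto intro: pm_Kset)

lemma pm_cscaleL:
  assumes x: "x \<in> AA"
  shows "p (cscaleL c x) = cmod c * p x"
proof (cases "c = 0")
  case True
  then show ?thesis by (simp add: cscaleL_simps pm_Kset)
next
  case False
  have "p (cscaleL (1/c) (cscaleL c x)) \<le> cmod (1/c) * p (cscaleL c x)"
    by (intro pm_cscaleL_le AA_cscaleL x)
  then have "cmod c * p x \<le> p (cscaleL c x)" using False by (simp add: cscaleL_simps norm_divide field_simps)
  then show ?thesis using pm_cscaleL_le[OF x, of c] by simp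
qed

lemma pm_swap:
  assumes "x \<in> AA" "y \<in> AA" "z \<in> AA" "w \<in> AA"
  shows "p (x o\<^sub>L (y o\<^sub>L (z o\<^sub>L w))) = p (x o\<^sub>L (z o\<^sub>L (y o\<^sub>L w)))"
proof (rule pm_cong)
  have "(x o\<^sub>L (y o\<^sub>L (z o\<^sub>L w))) - (x o\<^sub>L (z o\<^sub>L (y o\<^sub>L w))) = x o\<^sub>L (((y o\<^sub>L z) - (z o\<^sub>L y)) o\<^sub>L w)"
    by (simp add: compose_simps)
  also have "\<dots> \<in> Kset" by (intro Kset_compose_left Kset_compose_right comm AA_BH assms)
  finally show "(x o\<^sub>L (y o\<^sub>L (z o\<^sub>L w))) - (x o\<^sub>L (z o\<^sub>L (y o\<^sub>L w))) \<in> Kset" .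
qed (intro AA_compose assms)+

text \<open>When \<open>p a = 1\<close> the sequence decreases, so the infimum is a limit. Keeping
  \<open>p x\<close> outside \<open>AA\<close> makes \<open>localized a \<le> p\<close> true as
  functions, as the comparison with a minimal seminorm requires.\<close>

definition localized :: "('h \<Rightarrow>\<^sub>L 'h) \<Rightarrow> ('h \<Rightarrow>\<^sub>L 'h) \<Rightarrow> real" where
  "localized a x = (if x \<in> AA then INF m. p (x o\<^sub>L opow a m) else p x)"

context
  fixes a assumes a: "a \<in> AA" and pa: "p a = 1"
begin

lemma localized_decseq:
  assumes x: "x \<in> AA"
  shows "decseq (\<lambda>m. p (x o\<^sub>L opow a m))"
proof (rule decseq_SucI)
  fix m
  have "p (x o\<^sub>L opow a (Suc m)) = p ((x o\<^sub>L opow a m) o\<^sub>L a)"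
    by (simp only: opow_Suc_right compose_simps)
  also have "\<dots> \<le> p (x o\<^sub>L opow a m) * p a" by (intro pm_compose_le AA_compose AA_opow x a)
  finally show "p (x o\<^sub>L opow a (Suc m)) \<le> p (x o\<^sub>L opow a m)" by (simp add: pa)
qed

lemma localized_tendsto:
  assumes x: "x \<in> AA"
  shows "(\<lambda>m. p (x o\<^sub>L opow a m)) \<longlonglongrightarrow> localized a x"
proof -
  have "bdd_below (range (\<lambda>m. p (x o\<^sub>L opow a m)))"
    by (rule bdd_belowI2[where m=0]) (rule pm_nonneg)
  from LIMSEQ_decseq_INF[OF this localized_decseq[OF x]] show ?thesis using x by (simp add: localized_def)
qed

lemma localized_le: "localized a x \<le> p x"
proof (cases "x \<in> AA")
  case True
  have "(INF m. p (x o\<^sub>L opow a m)) \<le> p (x o\<^sub>L opow a 0)"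
    by (rule cINF_lower) (use pm_nonneg in \<open>auto intro!: bdd_belowI2[where m=0]\<close>)
  then show ?thesis using True by (simp add: localized_def compose_simps)
qed (simp add: localized_def)

text \<open>Squaring gives the value 1 only at exponents \<open>2 ^ k\<close>; monotonicity fills
  the gaps.\<close>

lemma pm_opow: "p (opow a m) = 1"
proof -
  have two: "p (opow a (2 ^ k)) = 1" for k
  proof (induction k)
    case (Suc k)
    have "opow a (2 ^ Suc k) = opow a (2 ^ k) o\<^sub>L opow a (2 ^ k)"
      by (simp add: mult_2 flip: opow_add)
    then show ?case using Suc by (simp add: pm_square AA_opow a)
  qed (simp add: pa compose_simps)
  note d = decseqD[OF localized_decseq[OF AA_id], simplified compose_simps]
  show ?thesis
  proof (rule antisym)
    show "p (opow a m) \<le> 1" using d[of 0 m] by (simp add: pm_id)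
    show "1 \<le> p (opow a m)" using d[of m "2 ^ m"] two[of m] less_exp[of m] by simp
  qed
qed

lemma localized_shuffle:
  assumes "x \<in> AA" "y \<in> AA"
  shows "p ((x o\<^sub>L y) o\<^sub>L opow a (m + m)) = p ((x o\<^sub>L opow a m) o\<^sub>L (y o\<^sub>L opow a m))"
  using pm_swap[OF assms AA_opow[OF a] AA_opow[OF a], of m m] by (simp add: opow_add compose_simps)

lemma double_tendsto:
  assumes "x \<in> AA"
  shows "(\<lambda>m. p (x o\<^sub>L opow a (m + m))) \<longlonglongrightarrow> localized a x"
proof -
  have "strict_mono (\<lambda>m::nat. m + m)" by (rule strict_monoI) simp
  from LIMSEQ_subseq_LIMSEQ[OF localized_tendsto[OF assms] this] show ?thesis by (simp add: comp_def)
qed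

text \<open>Products are evaluated along even exponents, where \<open>localized_shuffle\<close>
  hands half of the power of \<open>a\<close> to each factor. Invariance under \<open>a\<close> is a
  shift of the index.\<close>

lemma pm_seminorm_localized: "pm_seminorm (insert a G) (localized a)"
  unfolding pm_seminorm_def
proof (intro conjI allI ballI)
  fix x
  show "0 \<le> localized a x"
    using LIMSEQ_le_const[OF localized_tendsto, of x 0] pm_nonneg by (auto simp: localized_def)
  show "localized a x \<le> qnorm x" using localized_le[of x] pm_le_qnorm[of x] by simp
next
  fix x y assume xy: "x \<in> AA" "y \<in> AA"
  show "localized a (x + y) \<le> localized a x + localized a y"
    by (rule LIMSEQ_le[OF localized_tendsto tendsto_add[OF localized_tendsto localized_tendsto]])
      (use xy in \<open>auto simp: compose_simps intro!: pm_add AA_add AA_compose AA_opow a\<close>)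
next
  fix x and c :: complex assume x: "x \<in> AA"
  show "localized a (cscaleL c x) \<le> cmod c * localized a x"
    by (rule LIMSEQ_le[OF localized_tendsto tendsto_mult[OF tendsto_const localized_tendsto]])
      (use x in \<open>auto simp: compose_cscaleL intro!: pm_cscaleL_le AA_cscaleL AA_compose AA_opow a\<close>)
next
  fix x y assume xy: "x \<in> AA" "y \<in> AA"
  show "localized a (x o\<^sub>L y) \<le> localized a x * localized a y"
  proof (rule LIMSEQ_le[OF double_tendsto tendsto_mult[OF localized_tendsto localized_tendsto]])
    show "\<exists>N. \<forall>m\<ge>N. p ((x o\<^sub>L y) o\<^sub>L opow a (m + m)) \<le> p (x o\<^sub>L opow a m) * p (y o\<^sub>L opow a m)"
      unfolding localized_shuffle[OF xy] by (intro exI allI impI pm_compose_le AA_compose AA_opow a xy)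
  qed (intro AA_compose xy)+
next
  fix x assume x: "x \<in> AA"
  have "(\<lambda>m. (p (x o\<^sub>L opow a m))\<^sup>2) \<longlonglongrightarrow> localized a (x o\<^sub>L x)"
    using double_tendsto[OF AA_compose[OF x x]] unfolding localized_shuffle[OF x x]
    by (simp add: pm_square AA_compose AA_opow a x)
  then show "localized a (x o\<^sub>L x) = (localized a x)\<^sup>2"
    using LIMSEQ_unique tendsto_power[OF localized_tendsto[OF x]] by blast
next
  show "localized a id_blinfun = 1"
    using localized_tendsto[OF AA_id] by (simp add: compose_simps pm_opow LIMSEQ_const_iff)
next
  fix c x assume c: "c \<in> insert a G" and x: "x \<in> AA"
  have cA: "c \<in> AA" using c a G by auto
  note l = localized_tendsto[OF AA_compose[OF x cA]]
  show "localized a (x o\<^sub>L c) = localized a x"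
  proof (cases "c = a")
    case True
    have "(\<lambda>m. p (x o\<^sub>L opow a (Suc m))) \<longlonglongrightarrow> localized a x"
      by (rule LIMSEQ_Suc[OF localized_tendsto[OF x]])
    then show ?thesis using l LIMSEQ_unique unfolding True opow.simps by (simp only: compose_simps) blast
  next
    case False
    then have cG: "c \<in> G" using c by simp
    have "p ((x o\<^sub>L c) o\<^sub>L opow a m) = p (x o\<^sub>L opow a m)" for m
    proof -
      have "p ((x o\<^sub>L c) o\<^sub>L opow a m) = p ((x o\<^sub>L opow a m) o\<^sub>L c)"
        using pm_swap[OF x cA AA_opow[OF a] AA_id, of m] by (simp add: compose_simps)
      also have "\<dots> = p (x o\<^sub>L opow a m)" by (intro pm_invariant cG AA_compose x AA_opow a)
      finally show ?thesis .
    qed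
    then show ?thesis using l localized_tendsto[OF x] LIMSEQ_unique by simp
  qed
qed

end

text \<open>Rescale \<open>y\<close> to \<open>a\<close> with \<open>p a = 1\<close>. The
  localization at \<open>a\<close> is admissible and below \<open>p\<close>, hence equal to
  \<open>p\<close>, so \<open>p\<close> is invariant under \<open>a\<close>; undoing the scaling
  gives the claim.\<close>

lemma pm_minimal_multiplicative:
  assumes min: "\<And>q. pm_seminorm G q \<Longrightarrow> q \<le> p \<Longrightarrow> q = p" and x: "x \<in> AA" and y: "y \<in> AA"
  shows "p (x o\<^sub>L y) = p x * p y"
proof (cases "p y = 0")
  case True
  then show ?thesis using pm_compose_le[OF x y] pm_nonneg[of "x o\<^sub>L y"] by simp
next
  case False
  define a where "a = cscaleL (of_real (1 / p y)) y"
  have a: "a \<in> AA" unfolding a_def by (intro AA_cscaleL y)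
  have pa: "p a = 1" using False pm_nonneg[of y] by (simp add: a_def pm_cscaleL y norm_divide)
  have L: "pm_seminorm (insert a G) (localized a)" by (rule pm_seminorm_localized[OF a pa])
  then have "pm_seminorm G (localized a)" by (simp add: pm_seminorm_def)
  moreover have "localized a \<le> p" by (rule le_funI) (rule localized_le[OF a pa])
  ultimately have "localized a = p" by (rule min)
  with L have "p (x o\<^sub>L a) = p x" using x by (simp add: pm_seminorm_def)
  moreover have "x o\<^sub>L a = cscaleL (of_real (1 / p y)) (x o\<^sub>L y)"
    unfolding a_def by (rule compose_cscaleL(2)) (rule AA_BH[OF x])
  ultimately have "(1 / p y) * p (x o\<^sub>L y) = p x"
    using pm_nonneg[of y] by (simp add: pm_cscaleL AA_compose x y norm_divide)
  then show ?thesis using False by (simp add: field_simps)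
qed

end

section \<open>Characters from multiplicative seminorms\<close>

primrec iter_sq :: "('h \<Rightarrow>\<^sub>L 'h) \<Rightarrow> nat \<Rightarrow> ('h \<Rightarrow>\<^sub>L 'h)" where
  "iter_sq x 0 = x"
| "iter_sq x (Suc k) = iter_sq x k o\<^sub>L iter_sq x k"

lemma AA_iter_sq: "x \<in> AA \<Longrightarrow> iter_sq x k \<in> AA"
  by (induction k) (auto intro: AA_compose)

abbreviation scalar :: "complex \<Rightarrow> ('h \<Rightarrow>\<^sub>L 'h)" where
  "scalar c \<equiv> cscaleL c id_blinfun"

lemma AA_scalar: "scalar c \<in> AA"
  by (intro AA_cscaleL AA_id)

lemma square_minus_scalar:
  assumes "y \<in> AA"
  shows "(y o\<^sub>L y) - scalar (c * c) = (y - scalar c) o\<^sub>L (y - scalar (- c))"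
  using AA_BH[OF assms]
  by (simp add: compose_simps compose_cscaleL BH_closed cscaleL_simps)

lemma cscaleL_diff:
  "cscaleL c (x - y) = cscaleL c x - cscaleL c y"
  "cscaleL (c - d) x = cscaleL c x - cscaleL d x"
  by (rule blinfun_eqI; simp add: cscaleL_apply blinfun.bilinear_simps jmul_simps algebra_simps)+

context
  fixes G :: "('h \<Rightarrow>\<^sub>L 'h) set" and p :: "('h \<Rightarrow>\<^sub>L 'h) \<Rightarrow> real"
  assumes p: "pm_seminorm G p" and G: "G \<subseteq> AA"
    and mult: "\<And>x y. x \<in> AA \<Longrightarrow> y \<in> AA \<Longrightarrow> p (x o\<^sub>L y) = p x * p y"
begin

lemma pm_diff_le:
  assumes "x \<in> AA" "y \<in> AA"
  shows "p (x - y) \<le> p x + p y"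
proof -
  have "p (x + cscaleL (-1) y) \<le> p x + p (cscaleL (-1) y)"
    by (intro pm_add[OF p G] assms AA_cscaleL)
  moreover have "cscaleL (-1) y = - y" by (simp add: cscaleL_simps)
  moreover have "p (cscaleL (-1) y) = p y" using pm_cscaleL[OF p G assms(2), of "-1"] by simp
  ultimately show ?thesis by simp
qed

lemma pm_scalar: "p (scalar c) = cmod c"
  using pm_cscaleL[OF p G AA_id, of c] pm_id[OF p G] by simp

text \<open>The factorisation of \<open>x\<^sup>n - c\<^sup>n\<close> with \<open>n = 2\<^sup>k\<close> and minimality of \<open>m\<close> give
  \<open>p (x - c) m\<^sup>n\<^sup>-\<^sup>1 \<le> m\<^sup>n + \<bar>c\<bar>\<^sup>n\<close>, hence \<open>p (x - c) \<le> m\<close> as \<open>n \<rightarrow> \<infinity>\<close>.\<close>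

lemma minimal_distance_spreads:
  assumes x: "x \<in> AA" and px: "p x = m" and m: "m > 0" and min: "\<And>d. m \<le> p (x - scalar d)"
    and c: "cmod c < m"
  shows "p (x - scalar c) = m"
proof (rule antisym)
  \<comment> \<open>Every scalar has a complex square root, so a square minus \<open>d\<close>
    factors into two elements of the same form, and the lower bound is squared at each
    stage.\<close>
  have low: "m ^ (2 ^ k) \<le> p (iter_sq x k - scalar d)" for k d
  proof (induction k arbitrary: d)
    case 0
    then show ?case using min by simp
  next
    case (Suc k)
    define r where "r = csqrt d"
    have d: "d = r * r" using power2_csqrt[of d] by (simp add: r_def power2_eq_square)
    have "p (iter_sq x (Suc k) - scalar d) = p (iter_sq x k - scalar r) * p (iter_sq x k - scalar (- r))"
      unfolding d iter_sq.simps square_minus_scalar[OF AA_iter_sq[OF x]]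
      by (intro mult AA_diff AA_scalar AA_iter_sq x)
    moreover have "m ^ (2 ^ k) * m ^ (2 ^ k) \<le> p (iter_sq x k - scalar r) * p (iter_sq x k - scalar (- r))"
      by (intro mult_mono Suc pm_nonneg[OF p G]) (use m in auto)
    ultimately show ?case by (simp add: mult_2 power_add)
  qed
  have up: "p (iter_sq x k) = m ^ (2 ^ k)" for k
    by (induction k) (simp_all add: px mult AA_iter_sq x mult_2 power_add)
  \<comment> \<open>Of the full factorisation only \<open>x - scalar c\<close> is kept; at each
    doubling the new factor is estimated from below by \<open>low\<close>. The \<open>m\<close> on
    the right makes up for the missing power.\<close>
  have fac: "p (x - scalar c) * m ^ (2 ^ k) \<le> m * p (iter_sq x k - scalar (c ^ (2 ^ k)))" for k
  proof (induction k)
    case 0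
    then show ?case by simp
  next
    case (Suc k)
    let ?y = "iter_sq x k" and ?c = "c ^ (2 ^ k)"
    have "p (x - scalar c) * m ^ (2 ^ k) * m ^ (2 ^ k) \<le> m * p (?y - scalar ?c) * p (?y - scalar (- ?c))"
      by (intro mult_mono Suc low) (use m pm_nonneg[OF p G] in auto)
    also have "\<dots> = m * p (iter_sq x (Suc k) - scalar (?c * ?c))"
      unfolding iter_sq.simps square_minus_scalar[OF AA_iter_sq[OF x]]
      by (subst mult) (auto intro!: AA_diff AA_scalar AA_iter_sq x)
    finally show ?case by (simp add: mult_2 power_add mult.assoc)
  qed
  have "p (x - scalar c) \<le> m * (1 + (cmod c / m) ^ k)" for k
  proof -
    have "p (x - scalar c) * m ^ (2 ^ k) \<le> m * (p (iter_sq x k) + p (scalar (c ^ (2 ^ k))))"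
      by (rule order_trans[OF fac]) (intro mult_left_mono pm_diff_le AA_iter_sq AA_scalar x, use m in simp)
    also have "\<dots> = m * (m ^ (2 ^ k) + cmod c ^ (2 ^ k))" by (simp add: up pm_scalar norm_power)
    finally have "p (x - scalar c) \<le> m * (1 + (cmod c / m) ^ (2 ^ k))"
      using m by (simp add: field_simps power_divide)
    also have "\<dots> \<le> m * (1 + (cmod c / m) ^ k)"
      using m c less_exp[of k] by (intro mult_left_mono add_left_mono power_decreasing) auto
    finally show ?thesis .
  qed
  moreover have "(\<lambda>k. m * (1 + (cmod c / m) ^ k)) \<longlonglongrightarrow> m * (1 + 0)"
    using m c by (intro tendsto_intros LIMSEQ_realpow_zero) auto
  ultimately show "p (x - scalar c) \<le> m" by (intro LIMSEQ_le_const[where X="\<lambda>k. m * (1 + (cmod c / m) ^ k)"]) auto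
qed (rule min)

text \<open>The Gelfand-Mazur step without resolvents: the distance \<open>N\<close> to the scalars
  attains its minimum, and a positive minimum would spread from disc to disc towards infinity, where
  \<open>N\<close> is large.\<close>

lemma multiplicative_seminorm_scalar:
  assumes a: "a \<in> AA"
  shows "\<exists>l. p (a - scalar l) = 0"
proof -
  define N where "N l = p (a - scalar l)" for l
  have sc: "a - scalar l \<in> AA" for l by (intro AA_diff AA_scalar a)
  have diff: "N l \<le> N k + dist l k" for l k
  proof -
    have "a - scalar l = (a - scalar k) + scalar (k - l)"
      by (simp add: cscaleL_diff)
    then have "N l \<le> N k + p (scalar (k - l))"
      unfolding N_def using pm_add[OF p G sc AA_scalar, of k "k - l"] by metis
    then show ?thesis by (simp add: pm_scalar dist_norm norm_minus_commute)
  qed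
  have "continuous_on UNIV N"
  proof (rule continuous_onI)
    fix x e assume e: "(e::real) > 0"
    show "\<exists>d>0. \<forall>x'\<in>UNIV. dist x' x < d \<longrightarrow> dist (N x') (N x) \<le> e"
    proof (intro exI[of _ e] conjI e ballI impI)
      fix x' assume "dist x' x < e"
      then show "dist (N x') (N x) \<le> e" using diff[of x' x] diff[of x x']
        by (simp add: dist_real_def dist_commute abs_le_iff)
    qed
  qed
  have N0: "N 0 = p a" by (simp add: N_def cscaleL_simps)
  have lowN: "cmod l - p a \<le> N l" for l
  proof -
    have "p (a - (a - scalar l)) \<le> p a + N l" unfolding N_def by (intro pm_diff_le a sc)
    then show ?thesis by (simp add: pm_scalar)
  qed
  \<comment> \<open>Beyond radius \<open>2 * p a\<close> the bound \<open>lowN\<close> exceeds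
    \<open>p a\<close>, which is \<open>N 0\<close>, so a minimum over this disc is global.\<close>
  have "\<exists>l0\<in>cball 0 (2 * p a). \<forall>l\<in>cball 0 (2 * p a). N l0 \<le> N l"
    by (rule continuous_attains_inf)
      (use pm_nonneg[OF p G, of a] \<open>continuous_on UNIV N\<close> in \<open>auto intro: continuous_on_subset\<close>)
  then obtain l0 where l0: "\<And>l. cmod l \<le> 2 * p a \<Longrightarrow> N l0 \<le> N l" by (meson mem_cball_0)
  have min: "N l0 \<le> N l" for l
  proof (cases "cmod l \<le> 2 * p a")
    case False
    have "N l0 \<le> N 0" using pm_nonneg[OF p G, of a] by (intro l0) simp
    then show ?thesis using False lowN[of l] N0 by linarith
  qed (rule l0)
  have "N l0 = 0"
  proof (rule ccontr)
    assume "N l0 \<noteq> 0"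
    then have m: "N l0 > 0" using pm_nonneg[OF p G, of "a - scalar l0"] by (simp add: N_def)
    have shift: "(a - scalar l) - scalar d = a - scalar (l + d)" for l d
      by (simp add: cscaleL_simps)
    have step: "N (l + d) = N l0" if "N l = N l0" "cmod d < N l0" for l d
      using minimal_distance_spreads[OF sc _ m _ that(2), of l] that(1) min
      unfolding shift by (simp add: N_def)
    \<comment> \<open>Half the radius keeps each move strictly inside the disc allowed by
      \<open>step\<close>.\<close>
    have "N (l0 + of_nat j * of_real (N l0 / 2)) = N l0" for j
    proof (induction j)
      case (Suc j)
      have "N ((l0 + of_nat j * of_real (N l0 / 2)) + of_real (N l0 / 2)) = N l0"
      proof (rule step[OF Suc])
        show "cmod (of_real (N l0 / 2)) < N l0" unfolding norm_of_real using m by simp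
      qed
      then show ?case by (simp add: algebra_simps add_divide_distrib)
    qed simp
    note all = this
    obtain j :: nat where j: "(N l0 + p a + cmod l0) / (N l0 / 2) < real j" using reals_Archimedean2 by blast
    then have "N l0 + p a + cmod l0 < real j * (N l0 / 2)" using m by (simp add: divide_less_eq)
    also have "\<dots> = cmod (of_nat j * of_real (N l0 / 2))" using m by (simp add: norm_mult norm_divide)
    also have "\<dots> \<le> cmod (l0 + of_nat j * of_real (N l0 / 2)) + cmod l0"
      using norm_triangle_ineq4[of "l0 + of_nat j * of_real (N l0 / 2)" l0] by simp
    finally show False using lowN[of "l0 + of_nat j * of_real (N l0 / 2)"] all[of j] by linarith
  qed
  then show ?thesis unfolding N_def by blast
qed

text \<open>\<open>\<kappa> a\<close> is the only scalar at \<open>p\<close>-distance zero from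
  \<open>a\<close>; each algebraic rule therefore reduces to checking that the expected scalar is at
  distance zero.\<close>

lemma multiplicative_seminorm_character: "\<exists>\<kappa>. character AA \<kappa> \<and> (\<forall>a\<in>AA. cmod (\<kappa> a) = p a)"
proof -
  obtain \<kappa> where \<kappa>: "\<And>a. a \<in> AA \<Longrightarrow> p (a - scalar (\<kappa> a)) = 0"
    using multiplicative_seminorm_scalar by metis
  have uniq: "\<kappa> a = l" if a: "a \<in> AA" and l: "p (a - scalar l) \<le> 0" for a l
  proof -
    have "p ((a - scalar l) - (a - scalar (\<kappa> a))) \<le> p (a - scalar l) + p (a - scalar (\<kappa> a))"
      by (intro pm_diff_le AA_diff AA_scalar a)
    moreover have "(a - scalar l) - (a - scalar (\<kappa> a)) = scalar (\<kappa> a - l)"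
      by (simp add: cscaleL_diff)
    ultimately have "cmod (\<kappa> a - l) \<le> 0" using l \<kappa>[OF a] by (simp only: pm_scalar)
    then show ?thesis by simp
  qed
  have sc: "a - scalar l \<in> AA" if "a \<in> AA" for a l by (intro AA_diff AA_scalar that)
  have "character AA \<kappa>" unfolding character_def clinear_on_def
  proof (intro conjI ballI allI)
    fix a b assume a: "a \<in> AA" and b: "b \<in> AA"
    show "\<kappa> (a + b) = \<kappa> a + \<kappa> b"
    proof (rule uniq)
      have eq: "(a + b) - scalar (\<kappa> a + \<kappa> b) = (a - scalar (\<kappa> a)) + (b - scalar (\<kappa> b))"
        by (simp add: cscaleL_simps)
      show "p ((a + b) - scalar (\<kappa> a + \<kappa> b)) \<le> 0"
        unfolding eq using pm_add[OF p G sc[OF a] sc[OF b], of "\<kappa> a" "\<kappa> b"] \<kappa>[OF a] \<kappa>[OF b] by simp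
    qed (intro AA_add a b)
    show "\<kappa> (a o\<^sub>L b) = \<kappa> a * \<kappa> b"
    proof (rule uniq)
      have eq: "(a o\<^sub>L b) - scalar (\<kappa> a * \<kappa> b) = ((a - scalar (\<kappa> a)) o\<^sub>L b) + (scalar (\<kappa> a) o\<^sub>L (b - scalar (\<kappa> b)))"
        by (simp add: compose_simps compose_cscaleL cscaleL_simps cscaleL_diff(1))
      have "p ((a o\<^sub>L b) - scalar (\<kappa> a * \<kappa> b)) \<le> p ((a - scalar (\<kappa> a)) o\<^sub>L b) + p (scalar (\<kappa> a) o\<^sub>L (b - scalar (\<kappa> b)))"
        unfolding eq by (rule pm_add[OF p G AA_compose[OF sc[OF a] b] AA_compose[OF AA_scalar sc[OF b]]])
      also have "\<dots> = 0" by (simp add: mult sc AA_scalar a b \<kappa>)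
      finally show "p ((a o\<^sub>L b) - scalar (\<kappa> a * \<kappa> b)) \<le> 0" .
    qed (intro AA_compose a b)
  next
    fix a and c :: complex assume a: "a \<in> AA"
    show "\<kappa> (cscaleL c a) = c * \<kappa> a"
    proof (rule uniq)
      have eq: "cscaleL c a - scalar (c * \<kappa> a) = cscaleL c (a - scalar (\<kappa> a))"
        by (simp add: cscaleL_diff(1) cscaleL_simps)
      show "p (cscaleL c a - scalar (c * \<kappa> a)) \<le> 0"
        unfolding eq using pm_cscaleL[OF p G sc[OF a], of c "\<kappa> a"] \<kappa>[OF a] by simp
    qed (intro AA_cscaleL a)
  next
    show "\<kappa> id_blinfun = 1"
      by (rule uniq[OF AA_id]) (simp add: cscaleL_simps pm_Kset[OF p G])
  qed
  moreover have "cmod (\<kappa> a) = p a" if a: "a \<in> AA" for a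
    using pm_eq_of_diff_null[OF p G a AA_scalar \<kappa>[OF a]] by (simp add: pm_scalar)
  ultimately show ?thesis by blast
qed

end

text \<open>Otherwise localizing the quotient norm at \<open>t\<close> and at \<open>b\<close> produces a character that is unimodular
  at \<open>t\<close> and does not vanish at \<open>b\<close>.\<close>

lemma qnorm_compose_opow_small:
  assumes \<omega>: "\<And>a. a \<in> AA \<Longrightarrow> cmod (\<omega> a) \<le> qnorm a" and \<omega>1: "\<omega> id_blinfun = 1" and \<omega>t: "\<omega> t = 1"
    and t: "t \<in> AA" "norm t \<le> 1"
    and peak: "\<And>\<kappa>. character AA \<kappa> \<Longrightarrow> \<exists>a\<in>AA. \<kappa> a \<noteq> \<omega> a \<Longrightarrow> cmod (\<kappa> t) < 1"
    and b: "b \<in> AA" "\<omega> b = 0" and e: "e > 0"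
  shows "\<exists>m. qnorm (b o\<^sub>L opow t m) < e"
proof -
  have "qnorm id_blinfun = 1"
    using \<omega>[OF AA_id] \<omega>1 qnorm_le_norm[of id_blinfun] norm_blinfun_id_le[where 'a='h] by simp
  then have q: "pm_seminorm {} qnorm" by (rule pm_seminorm_qnorm)
  have qt: "qnorm t = 1" using \<omega>[OF t(1)] \<omega>t qnorm_le_norm[of t] t(2) by simp
  define p1 where "p1 = localized qnorm t"
  have p1: "pm_seminorm {t} p1"
    unfolding p1_def by (rule pm_seminorm_localized[OF q _ t(1) qt]) simp
  have "p1 b = 0"
  proof (rule ccontr)
    assume "p1 b \<noteq> 0"
    have tG: "{t} \<subseteq> AA" using t by simp
    have p1b: "p1 b > 0" using \<open>p1 b \<noteq> 0\<close> pm_nonneg[OF p1 tG, of b] by simp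
    define c where "c = cscaleL (of_real (1 / p1 b)) b"
    have c: "c \<in> AA" unfolding c_def by (intro AA_cscaleL b)
    have p1c: "p1 c = 1" using p1b by (simp add: c_def pm_cscaleL[OF p1 tG] b norm_divide)
    have G: "{c, t} \<subseteq> AA" using c t by simp
    have "pm_seminorm {c, t} (localized p1 c)" by (rule pm_seminorm_localized[OF p1 tG c p1c])
    \<comment> \<open>Minimality is taken among seminorms invariant under both \<open>c\<close> and
      \<open>t\<close>; invariance at the identity then forces the value 1 at both.\<close>
    then obtain p where p: "pm_seminorm {c, t} p" and min: "\<And>q. pm_seminorm {c, t} q \<Longrightarrow> q \<le> p \<Longrightarrow> q = p"
      using pm_seminorm_minimal by blast
    have "p (x o\<^sub>L y) = p x * p y" if "x \<in> AA" "y \<in> AA" for x y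
      by (rule pm_minimal_multiplicative[OF p G min that])
    then obtain \<kappa> where \<kappa>: "character AA \<kappa>" "\<And>a. a \<in> AA \<Longrightarrow> cmod (\<kappa> a) = p a"
      using multiplicative_seminorm_character[OF p G] by blast
    have one: "p g = 1" if "g \<in> {c, t}" for g
      using pm_invariant[OF p G that AA_id] pm_id[OF p G] by (simp add: compose_simps)
    have "\<kappa> c = of_real (1 / p1 b) * \<kappa> b"
      using \<kappa>(1) b unfolding c_def character_def clinear_on_def by blast
    then have "\<kappa> b \<noteq> 0" using one[of c] \<kappa>(2)[OF c] by auto
    then have "\<exists>a\<in>AA. \<kappa> a \<noteq> \<omega> a" using b by metis
    from peak[OF \<kappa>(1) this] show False using \<kappa>(2)[OF t(1)] one[of t] by simp
  qed
  then have "(\<lambda>m. qnorm (b o\<^sub>L opow t m)) \<longlonglongrightarrow> 0"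
    using localized_tendsto[OF q _ t(1) qt b(1)] by (simp add: p1_def)
  then have "\<forall>\<^sub>F m in sequentially. qnorm (b o\<^sub>L opow t m) < e"
    using e by (rule order_tendstoD(2))
  then show ?thesis by (auto simp: eventually_sequentially)
qed

section \<open>The powers of a peaking element\<close>

lemma adjL_opow: "adjL (opow t n) = opow (adjL t) n"
  by (induction n) (simp_all flip: opow_Suc_right)

lemma opow_apply: "blinfun_apply (opow t n) x = (blinfun_apply t ^^ n) x"
  by (induction n) auto

text \<open>Split \<open>a\<close> into the scalar \<open>\<omega> a\<close> and a part
  \<open>b\<close> killed by \<omega>. The scalar part contributes exactly
  \<open>cmod (\<omega> a)\<close>, because the powers of \<open>t\<close> have norm 1: \<omega> is
  contractive and takes the value 1 on them.\<close>

lemma characteristic_sequence_opow: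
  assumes state: "state AA \<omega>" and kill: "\<And>k. k \<in> Kset \<Longrightarrow> \<omega> k = 0" and char: "character AA \<omega>"
    and t: "t \<in> AA" "pure_contraction t" "\<omega> t = 1"
    and peak: "\<And>\<kappa>. character AA \<kappa> \<Longrightarrow> \<exists>a\<in>AA. \<kappa> a \<noteq> \<omega> a \<Longrightarrow> cmod (\<kappa> t) < 1"
  shows "characteristic_sequence AA \<omega> (opow t)"
proof -
  have nt: "norm t \<le> 1" using t by (simp add: pure_contraction_def)
  have pow: "\<omega> (opow t n) = 1" for n
  proof (induction n)
    case (Suc n)
    have "\<omega> (t o\<^sub>L opow t n) = \<omega> t * \<omega> (opow t n)"
      using char t(1) AA_opow[OF t(1)] by (simp add: character_def)
    then show ?case using Suc t(3) by simp
  qed (use state_id[OF state] in simp)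
  have n1: "norm (opow t n) = 1" for n
    using norm_opow_le[OF nt, of n] state_bounded[OF state AA_opow[OF t(1)], of n] by (simp add: pow)
  have \<omega>q: "cmod (\<omega> a) \<le> qnorm a" if a: "a \<in> AA" for a
  proof (rule qnorm_greatest)
    fix k :: "'h \<Rightarrow>\<^sub>L 'h" assume k: "k \<in> Kset"
    have "\<omega> (a + k) = \<omega> a" using kill[OF k] by (simp add: state_add[OF state] a AA_K k)
    then show "cmod (\<omega> a) \<le> norm (a + k)"
      using state_bounded[OF state AA_add[OF a AA_K[OF k]]] by simp
  qed
  let ?S = "\<lambda>n. adjL (opow t n)"
  have nS: "norm (?S n) \<le> 1" for n by (simp add: n1)
  have S0: "(\<lambda>n. ?S n x) \<longlonglongrightarrow> 0" for x
    using t(2) by (simp add: pure_contraction_def adjL_opow opow_apply)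
  have lim: "\<forall>\<^sub>F n in sequentially. norm (?S n o\<^sub>L a o\<^sub>L opow t n) \<le> cmod (\<omega> a) + e"
    if a: "a \<in> AA" and e: "e > 0" for a e
  proof -
    define b where "b = a - scalar (\<omega> a)"
    have b: "b \<in> AA" unfolding b_def by (intro AA_diff AA_scalar a)
    have "\<omega> b = 0"
      by (simp add: b_def state_diff[OF state] a AA_scalar state_cscaleL[OF state] AA_id state_id[OF state])
    then have "\<exists>m. qnorm (b o\<^sub>L opow t m) < e/2"
      by (intro qnorm_compose_opow_small[where \<omega>=\<omega>] \<omega>q state_id[OF state] t nt peak b) (use e in auto)
    \<comment> \<open>The exponent \<open>m\<close> and the compact \<open>k\<close> are fixed
      before \<open>n\<close> grows.\<close>
    then obtain m where m: "qnorm (b o\<^sub>L opow t m) < e/2" by blast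
    then obtain k where k: "k \<in> Kset" "norm ((b o\<^sub>L opow t m) + k) < e/2" using qnorm_lessD by blast
    have "(\<lambda>n. norm (?S n o\<^sub>L k)) \<longlonglongrightarrow> 0"
      using tendsto_norm_zero[OF strong_null_compose_compact[OF k(1) nS S0]] .
    then have "\<forall>\<^sub>F n in sequentially. norm (?S n o\<^sub>L k) < e/2" by (rule order_tendstoD(2)) (use e in simp)
    with eventually_ge_at_top[of m] show ?thesis
    proof eventually_elim
      case (elim n)
      define r where "r = n - m"
      have tn: "opow t n = opow t m o\<^sub>L opow t r" using elim(1) by (simp add: r_def flip: opow_add)
      have ba: "a = scalar (\<omega> a) + b" by (simp add: b_def)
      have SB: "?S n \<in> BH" by (intro AA_BH AA_adjL AA_opow t)
      have "?S n o\<^sub>L a o\<^sub>L opow t n = cscaleL (\<omega> a) (?S n o\<^sub>L opow t n) + (?S n o\<^sub>L b o\<^sub>L opow t n)"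
        by (subst ba) (simp add: compose_simps compose_cscaleL compose_cscaleL(2)[OF SB])
      \<comment> \<open>The surplus power \<open>opow t r\<close> is a contraction, so smallness
        reached at exponent \<open>m\<close> persists for larger \<open>n\<close>; the subtracted
        term is small because \<open>?S n o\<^sub>L k\<close> tends to zero.\<close>
      also have "?S n o\<^sub>L b o\<^sub>L opow t n = (?S n o\<^sub>L ((b o\<^sub>L opow t m) + k) o\<^sub>L opow t r) - (?S n o\<^sub>L k o\<^sub>L opow t r)"
        by (simp add: tn compose_simps)
      finally have "norm (?S n o\<^sub>L a o\<^sub>L opow t n) \<le> norm (cscaleL (\<omega> a) (?S n o\<^sub>L opow t n))
          + (norm (?S n o\<^sub>L ((b o\<^sub>L opow t m) + k) o\<^sub>L opow t r) + norm (?S n o\<^sub>L k o\<^sub>L opow t r))"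
        by (simp only:) (rule order_trans[OF norm_triangle_ineq add_left_mono[OF norm_triangle_ineq4]])
      moreover have "norm (cscaleL (\<omega> a) (?S n o\<^sub>L opow t n)) = cmod (\<omega> a)"
        by (simp add: norm_adjL_compose n1)
      moreover have "norm (?S n o\<^sub>L ((b o\<^sub>L opow t m) + k) o\<^sub>L opow t r) \<le> e/2"
        using norm_blinfun_compose[of "?S n o\<^sub>L ((b o\<^sub>L opow t m) + k)" "opow t r"]
          norm_blinfun_compose[of "?S n" "(b o\<^sub>L opow t m) + k"] k(2) by (simp add: n1)
      moreover have "norm (?S n o\<^sub>L k o\<^sub>L opow t r) \<le> e/2"
        using norm_blinfun_compose[of "?S n o\<^sub>L k" "opow t r"] elim(2) by (simp add: n1)
      ultimately show ?case by linarith
    qed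
  qed
  have "limsup (\<lambda>n. ereal (norm (?S n o\<^sub>L a o\<^sub>L opow t n))) \<le> ereal (cmod (\<omega> a))" if a: "a \<in> AA" for a
  proof (rule ereal_le_epsilon2)
    fix e :: real assume e: "0 < e"
    have "limsup (\<lambda>n. ereal (norm (?S n o\<^sub>L a o\<^sub>L opow t n))) \<le> ereal (cmod (\<omega> a) + e)"
      by (rule Limsup_bounded) (use lim[OF a e] in simp)
    then show "limsup (\<lambda>n. ereal (norm (?S n o\<^sub>L a o\<^sub>L opow t n))) \<le> ereal (cmod (\<omega> a)) + ereal e" by simp
  qed
  then show ?thesis
    unfolding characteristic_sequence_def using AA_opow[OF t(1)] n1 by (simp add: pow)
qed

end

theorem theorem4p5:
  fixes AA A :: "('h::chilbert \<Rightarrow>\<^sub>L 'h) set"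
  assumes "unital_cstar_subalg AA"
    and "Kset \<subseteq> AA"
    and "\<forall>a\<in>AA. \<forall>b\<in>AA. (a o\<^sub>L b) - (b o\<^sub>L a) \<in> Kset"
    and "unital_closed_subalg A"
    and "A \<subseteq> AA"
    and "\<forall>\<omega>. character AA \<omega> \<longrightarrow>
           (\<exists>t\<in>A. pure_contraction t \<and> \<omega> t = 1 \<and>
              (\<forall>\<kappa>. character AA \<kappa> \<and> (\<exists>a\<in>AA. \<kappa> a \<noteq> \<omega> a) \<longrightarrow> cmod (\<kappa> t) < 1))"
  shows "\<forall>\<psi>. pure_state AA \<psi> \<longrightarrow>
           (\<exists>\<Delta>. characteristic_sequence AA \<psi> \<Delta> \<and> (\<forall>n. \<Delta> n \<in> opsys_plus_K A))"
proof (intro allI impI)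
  fix \<psi> assume pure: "pure_state AA \<psi>"
  interpret cstar_extension AA by unfold_locales (use assms in auto)
  have \<psi>: "state AA \<psi>" using pure by (simp add: pure_state_def)
  have A0: "0 \<in> A" and A1: "id_blinfun \<in> A" and Amult: "\<And>a b. a \<in> A \<Longrightarrow> b \<in> A \<Longrightarrow> a o\<^sub>L b \<in> A"
    using assms(4) by (auto simp: unital_closed_subalg_def complex_subspace_def)
  show "\<exists>\<Delta>. characteristic_sequence AA \<psi> \<Delta> \<and> (\<forall>n. \<Delta> n \<in> opsys_plus_K A)"
  proof (cases "\<forall>v e. \<psi> (rank1 v e) = 0")
    case False
    then obtain u where u: "norm u = 1" "\<And>a. a \<in> AA \<Longrightarrow> \<psi> a = vector_state u a"
      using pure_state_vector_state[OF pure] by blast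
    \<comment> \<open>The projection is supplied by the compact summand, with 0 for both elements of
      \<open>A\<close>.\<close>
    have "rank1 u u \<in> opsys_plus_K A"
      unfolding opsys_plus_K_def using A0 rank1_Kset[of u u]
      by (intro CollectI exI[of _ 0] exI[of _ "rank1 u u"]) simp
    then show ?thesis using characteristic_sequence_vector_state[OF u] by blast
  next
    case True
    have kill: "\<psi> k = 0" if "k \<in> Kset" for k
      by (rule state_vanishes_Kset[OF \<psi> _ that]) (use True in simp)
    have char: "character AA \<psi>"
      using \<psi> pure_state_multiplicative[OF pure kill] by (simp add: character_def state_def)
    then obtain t where t: "t \<in> A" "pure_contraction t" "\<psi> t = 1"
      and peak: "\<And>\<kappa>. character AA \<kappa> \<Longrightarrow> \<exists>a\<in>AA. \<kappa> a \<noteq> \<psi> a \<Longrightarrow> cmod (\<kappa> t) < 1"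
      using assms(6) by blast
    have "opow t n \<in> A" for n by (induction n) (auto intro: A1 Amult t)
    then have "opow t n \<in> opsys_plus_K A" for n
      unfolding opsys_plus_K_def using A0 by (intro CollectI exI[of _ "opow t n"] exI[of _ 0]) simp
    moreover have "characteristic_sequence AA \<psi> (opow t)"
      using t(1) assms(5) by (intro characteristic_sequence_opow \<psi> kill char t(2,3) peak) auto
    ultimately show ?thesis by blast
  qed
qed

end
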